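(* Let $p$ be an odd prime and let $a\in\mathbb{Z}_p$. Then $$\int_{\mathbb{Z}_p}\cos(ax)\,d\mu_{-1}(x)=1,\qquad \int_{\mathbb{Z}_p}\sin(ax)\,d\mu_{-1}(x)=-\frac{\sin a}{\cos a+1}=-\tan\frac a2.$$
   Context: Here $\sin$ and $\cos$ are the $p$-adic functions given by their usual power series and $\tan=\sin/\cos$. For a strictly differentiable function $f$ on $\mathbb{Z}_p$ (i.e. $f\in C^{(1)}(\mathbb{Z}_p)$), the fermionic $p$-adic integral (the $p$-adic $q$-integral at $q=-1$) is $$\int_{\mathbb{Z}_p}f(x)\,d\mu_{-1}(x)=\lim_{N\to\infty}\sum_{x=0}^{p^N-1}f(x)(-1)^x.$$
   Formalization: The power series of sin(ax) and cos(ax) are additionally assumed to converge for every x in Z_p (for odd p this means a ∈ pZ_p); for a unit a they diverge at x = 1, so the stated integrands are undefined. *)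

theory Defs
  imports Complex_Main "Berlekamp_Zassenhaus.Finite_Field"
begin

hide_const (open) Fraction_Field.Fract

section \<open>The \<open>p\<close>-adic absolute value on the rationals\<close>

definition padic_abs :: "nat \<Rightarrow> rat \<Rightarrow> real" where
  "padic_abs p r = (if r = 0 then 0 else
     (let (a, b) = quotient_of r in
        real p powi (int (multiplicity (int p) b) - int (multiplicity (int p) a))))"

lemma padic_abs_0 [simp]: "padic_abs p 0 = 0"
  by (simp add: padic_abs_def)

lemma padic_abs_Fract:
  assumes p: "prime p" and a: "a \<noteq> 0" and b: "b \<noteq> 0"
  shows "padic_abs p (Fract a b) =
    real p powi (int (multiplicity (int p) b) - int (multiplicity (int p) a))"
proof -
  obtain c d where cd: "quotient_of (Fract a b) = (c, d)" by (cases "quotient_of (Fract a b)")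
  have d: "d > 0" using quotient_of_denom_pos[OF cd] .
  have eq: "Fract a b = Fract c d" using quotient_of_div[OF cd] by (simp add: Fract_of_int_quotient)
  have ad: "a * d = c * b" using eq b d by (simp add: eq_rat)
  have c: "c \<noteq> 0" using ad a d by auto
  have nz: "Fract a b \<noteq> 0" using a b by (simp add: Zero_rat_def eq_rat)
  have pe: "prime_elem (int p)" using p by simp
  have "multiplicity (int p) (a * d) = multiplicity (int p) (c * b)" using ad by simp
  hence "multiplicity (int p) a + multiplicity (int p) d =
         multiplicity (int p) c + multiplicity (int p) b"
    using a b c d by (simp add: prime_elem_multiplicity_mult_distrib[OF pe])
  hence "int (multiplicity (int p) d) - int (multiplicity (int p) c) =
         int (multiplicity (int p) b) - int (multiplicity (int p) a)"
    by linarith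
  thus ?thesis using nz cd by (simp add: padic_abs_def)
qed

lemma padic_abs_pos: "prime p \<Longrightarrow> r \<noteq> 0 \<Longrightarrow> padic_abs p r > 0"
  using prime_gt_0_nat[of p] by (auto simp: padic_abs_def split: prod.splits)

lemma padic_abs_nonneg [simp]: "padic_abs p r \<ge> 0"
  by (auto simp: padic_abs_def split: prod.splits)

lemma padic_abs_eq_0_iff: "prime p \<Longrightarrow> padic_abs p r = 0 \<longleftrightarrow> r = 0"
  using padic_abs_pos[of p r] by force

lemma padic_abs_mult:
  assumes p: "prime p"
  shows "padic_abs p (r * s) = padic_abs p r * padic_abs p s"
proof (cases "r = 0 \<or> s = 0")
  case False
  obtain a b where r: "r = Fract a b" "b > 0" using Rat_cases by metis
  obtain c d where s: "s = Fract c d" "d > 0" using Rat_cases by metis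
  have ac: "a \<noteq> 0" "c \<noteq> 0" using False r s by (auto simp: rat_number_collapse)
  have p0: "real p \<noteq> 0" using prime_gt_0_nat[OF p] by simp
  have pe: "prime_elem (int p)" using p by simp
  show ?thesis
    using ac r s p0
    by (simp add: padic_abs_Fract[OF p] prime_elem_multiplicity_mult_distrib[OF pe]
        power_int_add[symmetric] algebra_simps)
qed auto

lemma padic_abs_1 [simp]: "padic_abs p 1 = 1"
  by (simp add: padic_abs_def)

lemma padic_abs_minus [simp]: "padic_abs p (- r) = padic_abs p r"
proof -
  have "multiplicity q (- k) = multiplicity q k" for q k :: int
    unfolding multiplicity_def by simp
  thus ?thesis by (simp add: padic_abs_def rat_uminus_code split: prod.splits)
qed

lemma padic_abs_minus_commute: "padic_abs p (r - s) = padic_abs p (s - r)"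
  using padic_abs_minus[of p "r - s"] by simp

lemma padic_abs_inverse:
  assumes p: "prime p" shows "padic_abs p (inverse r) = inverse (padic_abs p r)"
proof (cases "r = 0")
  case False
  have "padic_abs p (inverse r) * padic_abs p r = 1"
    using False by (simp add: padic_abs_mult[OF p, symmetric])
  thus ?thesis by (metis inverse_unique mult.commute)
qed auto

lemma padic_abs_ultrametric:
  assumes p: "prime p"
  shows "padic_abs p (r + s) \<le> max (padic_abs p r) (padic_abs p s)"
proof (cases "r = 0 \<or> s = 0 \<or> r + s = 0")
  case False
  obtain a b where r: "r = Fract a b" "b > 0" using Rat_cases by metis
  obtain c d where s: "s = Fract c d" "d > 0" using Rat_cases by metis
  have ac: "a \<noteq> 0" "c \<noteq> 0" using False r s by (auto simp: rat_number_collapse)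
  have p1: "real p > 1" using prime_gt_1_nat[OF p] by simp
  have pe: "prime_elem (int p)" using p by simp
  let ?m = "multiplicity (int p)"
  have rs: "r + s = Fract (a * d + c * b) (b * d)" using r s by simp
  have nz: "a * d + c * b \<noteq> 0" using False rs by (auto simp: rat_number_collapse)
  define k where "k = min (?m (a * d)) (?m (c * b))"
  have "int p ^ k dvd a * d" "int p ^ k dvd c * b"
    unfolding k_def by (simp_all add: multiplicity_dvd')
  hence "int p ^ k dvd a * d + c * b" by simp
  hence k: "k \<le> ?m (a * d + c * b)"
    using nz pe p by (intro multiplicity_geI) (auto simp: prime_elem_def)
  have A: "padic_abs p (r + s) = real p powi (int (?m (b * d)) - int (?m (a * d + c * b)))"
    unfolding rs using nz r s by (subst padic_abs_Fract[OF p]) auto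
  have B: "padic_abs p r = real p powi (int (?m (b * d)) - int (?m (a * d)))"
    using ac r s by (simp add: padic_abs_Fract[OF p] prime_elem_multiplicity_mult_distrib[OF pe])
  have C: "padic_abs p s = real p powi (int (?m (b * d)) - int (?m (c * b)))"
    using ac r s by (simp add: padic_abs_Fract[OF p] prime_elem_multiplicity_mult_distrib[OF pe])
  show ?thesis
  proof (cases "?m (a * d) \<le> ?m (c * b)")
    case True
    hence "padic_abs p (r + s) \<le> padic_abs p r"
      unfolding A B using k p1 by (intro power_int_increasing) (auto simp: k_def)
    thus ?thesis by simp
  next
    case F: False
    hence "padic_abs p (r + s) \<le> padic_abs p s"
      unfolding A C using k p1 by (intro power_int_increasing) (auto simp: k_def)
    thus ?thesis by simp
  qed
qed (auto simp: le_max_iff_disj)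

lemma padic_abs_triangle:
  "prime p \<Longrightarrow> padic_abs p (r + s) \<le> padic_abs p r + padic_abs p s"
  using padic_abs_ultrametric[of p r s] padic_abs_nonneg[of p r] padic_abs_nonneg[of p s]
  by linarith

lemma padic_abs_diff_triangle:
  assumes "prime p"
  shows "\<bar>padic_abs p r - padic_abs p s\<bar> \<le> padic_abs p (r - s)"
  using padic_abs_triangle[OF assms, of "r - s" s] padic_abs_triangle[OF assms, of "s - r" r]
  by (simp add: padic_abs_minus_commute[of p s r])


section \<open>Cauchy and null sequences of rationals\<close>

definition padic_null :: "nat \<Rightarrow> (nat \<Rightarrow> rat) \<Rightarrow> bool" where
  "padic_null p X \<longleftrightarrow> (\<lambda>n. padic_abs p (X n)) \<longlonglongrightarrow> 0"

definition padic_Cauchy :: "nat \<Rightarrow> (nat \<Rightarrow> rat) \<Rightarrow> bool" where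
  "padic_Cauchy p X \<longleftrightarrow>
     (\<forall>e>0. \<exists>M. \<forall>m\<ge>M. \<forall>n\<ge>M. padic_abs p (X m - X n) < e)"

definition padic_rel :: "nat \<Rightarrow> (nat \<Rightarrow> rat) \<Rightarrow> (nat \<Rightarrow> rat) \<Rightarrow> bool" where
  "padic_rel p X Y \<longleftrightarrow> padic_Cauchy p X \<and> padic_Cauchy p Y \<and> padic_null p (\<lambda>n. X n - Y n)"

context
  fixes p :: nat
  assumes p: "prime p"
begin

lemma padic_null_const: "padic_null p (\<lambda>n. c) \<longleftrightarrow> c = 0"
  by (simp add: padic_null_def tendsto_const_iff padic_abs_eq_0_iff[OF p])

lemma padic_null_minus: "padic_null p X \<Longrightarrow> padic_null p (\<lambda>n. - X n)"
  by (simp add: padic_null_def)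

lemma padic_null_add:
  assumes "padic_null p X" "padic_null p Y"
  shows "padic_null p (\<lambda>n. X n + Y n)"
  unfolding padic_null_def
proof (rule tendsto_sandwich[OF _ _ tendsto_const])
  show "(\<lambda>n. padic_abs p (X n) + padic_abs p (Y n)) \<longlonglongrightarrow> 0"
    using tendsto_add[of _ 0 _ _ 0] assms by (fastforce simp: padic_null_def)
qed (auto simp: padic_abs_triangle[OF p])

lemma padic_null_diff:
  "padic_null p X \<Longrightarrow> padic_null p Y \<Longrightarrow> padic_null p (\<lambda>n. X n - Y n)"
  using padic_null_add[OF _ padic_null_minus] by fastforce

lemma padic_null_mult_bounded:
  assumes "\<And>n. padic_abs p (X n) \<le> B" "padic_null p Y"
  shows "padic_null p (\<lambda>n. X n * Y n)"
  unfolding padic_null_def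
proof (rule tendsto_sandwich[OF _ _ tendsto_const])
  show "(\<lambda>n. B * padic_abs p (Y n)) \<longlonglongrightarrow> 0"
    using tendsto_mult_left[of "\<lambda>n. padic_abs p (Y n)" 0 sequentially B] assms(2)
    by (simp add: padic_null_def)
  show "\<forall>\<^sub>F n in sequentially. padic_abs p (X n * Y n) \<le> B * padic_abs p (Y n)"
    using assms(1) by (intro always_eventually allI) (simp add: padic_abs_mult[OF p] mult_right_mono)
qed auto

lemma padic_Cauchy_const: "padic_Cauchy p (\<lambda>n. c)"
  by (simp add: padic_Cauchy_def)

lemma padic_Cauchy_minus: "padic_Cauchy p X \<Longrightarrow> padic_Cauchy p (\<lambda>n. - X n)"
  using padic_abs_minus_commute by (simp add: padic_Cauchy_def)

lemma padic_Cauchy_add: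
  assumes X: "padic_Cauchy p X" and Y: "padic_Cauchy p Y"
  shows "padic_Cauchy p (\<lambda>n. X n + Y n)"
  unfolding padic_Cauchy_def
proof (intro allI impI)
  fix e :: real assume e: "e > 0"
  obtain M where M: "\<forall>m\<ge>M. \<forall>n\<ge>M. padic_abs p (X m - X n) < e"
    using X e unfolding padic_Cauchy_def by blast
  obtain N where N: "\<forall>m\<ge>N. \<forall>n\<ge>N. padic_abs p (Y m - Y n) < e"
    using Y e unfolding padic_Cauchy_def by blast
  have "padic_abs p (X m + Y m - (X n + Y n)) < e" if "m \<ge> max M N" "n \<ge> max M N" for m n
  proof -
    have "padic_abs p (X m + Y m - (X n + Y n)) = padic_abs p ((X m - X n) + (Y m - Y n))"
      by (simp add: algebra_simps)
    also have "\<dots> \<le> max (padic_abs p (X m - X n)) (padic_abs p (Y m - Y n))"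
      by (rule padic_abs_ultrametric[OF p])
    also have "\<dots> < e" using M N that by auto
    finally show ?thesis .
  qed
  thus "\<exists>M. \<forall>m\<ge>M. \<forall>n\<ge>M. padic_abs p (X m + Y m - (X n + Y n)) < e" by blast
qed

lemma padic_Cauchy_abs_convergent:
  assumes X: "padic_Cauchy p X"
  shows "convergent (\<lambda>n. padic_abs p (X n))"
proof -
  have "Cauchy (\<lambda>n. padic_abs p (X n))"
  proof (rule metric_CauchyI)
    fix e :: real assume "e > 0"
    then obtain M where "\<forall>m\<ge>M. \<forall>n\<ge>M. padic_abs p (X m - X n) < e"
      using X unfolding padic_Cauchy_def by blast
    thus "\<exists>M. \<forall>m\<ge>M. \<forall>n\<ge>M. dist (padic_abs p (X m)) (padic_abs p (X n)) < e"
      by (metis dist_real_def padic_abs_diff_triangle[OF p] order.strict_trans1)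
  qed
  thus ?thesis by (rule Cauchy_convergent)
qed

lemma padic_Cauchy_bounded:
  assumes X: "padic_Cauchy p X"
  obtains B where "B > 0" "\<And>n. padic_abs p (X n) \<le> B"
proof -
  obtain B where "B > 0" "\<forall>n. norm (padic_abs p (X n)) \<le> B"
    using convergent_imp_Bseq[OF padic_Cauchy_abs_convergent[OF X]] by (auto elim: BseqE)
  thus ?thesis using that by simp
qed

lemma padic_Cauchy_mult:
  assumes X: "padic_Cauchy p X" and Y: "padic_Cauchy p Y"
  shows "padic_Cauchy p (\<lambda>n. X n * Y n)"
  unfolding padic_Cauchy_def
proof (intro allI impI)
  fix e :: real assume e: "e > 0"
  obtain A where A: "A > 0" "\<And>n. padic_abs p (X n) \<le> A" using padic_Cauchy_bounded[OF X] by blast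
  obtain B where B: "B > 0" "\<And>n. padic_abs p (Y n) \<le> B" using padic_Cauchy_bounded[OF Y] by blast
  obtain M where M: "\<forall>m\<ge>M. \<forall>n\<ge>M. padic_abs p (X m - X n) < e / B"
    using X e B(1) unfolding padic_Cauchy_def by (metis divide_pos_pos)
  obtain N where N: "\<forall>m\<ge>N. \<forall>n\<ge>N. padic_abs p (Y m - Y n) < e / A"
    using Y e A(1) unfolding padic_Cauchy_def by (metis divide_pos_pos)
  have "padic_abs p (X m * Y m - X n * Y n) < e" if mn: "m \<ge> max M N" "n \<ge> max M N" for m n
  proof -
    have "padic_abs p (X m * Y m - X n * Y n) =
          padic_abs p (X m * (Y m - Y n) + (X m - X n) * Y n)"
      by (simp add: algebra_simps)
    also have "\<dots> \<le> max (padic_abs p (X m) * padic_abs p (Y m - Y n))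
                         (padic_abs p (X m - X n) * padic_abs p (Y n))"
      using padic_abs_ultrametric[OF p] by (simp add: padic_abs_mult[OF p, symmetric])
    also have "\<dots> < e"
    proof -
      have "padic_abs p (X m) * padic_abs p (Y m - Y n) \<le> A * padic_abs p (Y m - Y n)"
        using A by (intro mult_right_mono) auto
      also have "\<dots> < A * (e / A)" using N mn A by (intro mult_strict_left_mono) auto
      finally have 1: "padic_abs p (X m) * padic_abs p (Y m - Y n) < e" using A by simp
      have "padic_abs p (X m - X n) * padic_abs p (Y n) \<le> padic_abs p (X m - X n) * B"
        using B by (intro mult_left_mono) auto
      also have "\<dots> < (e / B) * B" using M mn B by (intro mult_strict_right_mono) auto
      finally have 2: "padic_abs p (X m - X n) * padic_abs p (Y n) < e" using B by simp
      show ?thesis using 1 2 by simp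
    qed
    finally show ?thesis .
  qed
  thus "\<exists>M. \<forall>m\<ge>M. \<forall>n\<ge>M. padic_abs p (X m * Y m - X n * Y n) < e" by blast
qed

lemma padic_Cauchy_not_null:
  assumes X: "padic_Cauchy p X" and nz: "\<not> padic_null p X"
  obtains b k where "b > 0" "\<And>n. n \<ge> k \<Longrightarrow> padic_abs p (X n) > b"
proof -
  obtain L where L: "(\<lambda>n. padic_abs p (X n)) \<longlonglongrightarrow> L"
    using padic_Cauchy_abs_convergent[OF X] by (auto simp: convergent_def)
  have "L \<ge> 0" by (rule LIMSEQ_le_const[OF L]) auto
  moreover have "L \<noteq> 0" using L nz by (auto simp: padic_null_def)
  ultimately have "L > 0" by simp
  hence "\<forall>\<^sub>F n in sequentially. padic_abs p (X n) > L / 2"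
    using order_tendstoD(1)[OF L, of "L / 2"] by simp
  then obtain k where "\<And>n. n \<ge> k \<Longrightarrow> padic_abs p (X n) > L / 2"
    by (auto simp: eventually_sequentially)
  thus ?thesis using that[of "L / 2" k] \<open>L > 0\<close> by simp
qed

lemma padic_Cauchy_inverse:
  assumes X: "padic_Cauchy p X" and nz: "\<not> padic_null p X"
  shows "padic_Cauchy p (\<lambda>n. inverse (X n))"
  unfolding padic_Cauchy_def
proof (intro allI impI)
  fix e :: real assume e: "e > 0"
  obtain b k where b: "b > 0" and k: "\<And>n. n \<ge> k \<Longrightarrow> padic_abs p (X n) > b"
    using padic_Cauchy_not_null[OF X nz] by metis
  have "b * e * b > 0" using b e by simp
  then obtain M where M: "\<forall>m\<ge>M. \<forall>n\<ge>M. padic_abs p (X m - X n) < b * e * b"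
    using X unfolding padic_Cauchy_def by blast
  have "padic_abs p (inverse (X m) - inverse (X n)) < e" if mn: "m \<ge> max M k" "n \<ge> max M k" for m n
  proof -
    have gt: "padic_abs p (X m) > b" "padic_abs p (X n) > b" using k mn by auto
    hence nz: "X m \<noteq> 0" "X n \<noteq> 0" using b by auto
    have "inverse (X m) - inverse (X n) = - (inverse (X m) * (X m - X n) * inverse (X n))"
      by (rule inverse_diff_inverse[OF nz])
    hence "padic_abs p (inverse (X m) - inverse (X n)) =
      inverse (padic_abs p (X m)) * padic_abs p (X m - X n) * inverse (padic_abs p (X n))"
      by (simp add: padic_abs_mult[OF p] padic_abs_inverse[OF p])
    also have "\<dots> \<le> inverse b * padic_abs p (X m - X n) * inverse b"
      using gt b by (intro mult_mono le_imp_inverse_le) auto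
    also have "\<dots> < inverse b * (b * e * b) * inverse b"
      using M mn b by (intro mult_strict_right_mono mult_strict_left_mono) auto
    also have "\<dots> = e" using b by simp
    finally show ?thesis .
  qed
  thus "\<exists>M. \<forall>m\<ge>M. \<forall>n\<ge>M. padic_abs p (inverse (X m) - inverse (X n)) < e" by blast
qed

lemma padic_null_diff_inverse:
  assumes X: "padic_Cauchy p X" "\<not> padic_null p X"
    and Y: "padic_Cauchy p Y" "\<not> padic_null p Y"
    and XY: "padic_null p (\<lambda>n. X n - Y n)"
  shows "padic_null p (\<lambda>n. inverse (X n) - inverse (Y n))"
proof -
  obtain a i where a: "a > 0" and i: "\<And>n. n \<ge> i \<Longrightarrow> padic_abs p (X n) > a"
    using padic_Cauchy_not_null[OF X] by metis
  obtain b j where b: "b > 0" and j: "\<And>n. n \<ge> j \<Longrightarrow> padic_abs p (Y n) > b"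
    using padic_Cauchy_not_null[OF Y] by metis
  obtain A where A: "A > 0" "\<And>n. padic_abs p (inverse (X n)) \<le> A"
    using padic_Cauchy_bounded[OF padic_Cauchy_inverse[OF X]] by blast
  obtain B where B: "B > 0" "\<And>n. padic_abs p (inverse (Y n)) \<le> B"
    using padic_Cauchy_bounded[OF padic_Cauchy_inverse[OF Y]] by blast
  have "padic_abs p (- (inverse (X n) * inverse (Y n))) \<le> A * B" for n
    using A B by (simp add: padic_abs_mult[OF p] mult_mono)
  hence "padic_null p (\<lambda>n. - (inverse (X n) * inverse (Y n)) * (X n - Y n))"
    using XY by (rule padic_null_mult_bounded)
  moreover have "\<forall>\<^sub>F n in sequentially.
      padic_abs p (- (inverse (X n) * inverse (Y n)) * (X n - Y n)) =
      padic_abs p (inverse (X n) - inverse (Y n))"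
  proof (rule eventually_sequentiallyI[of "max i j"])
    fix n assume "n \<ge> max i j"
    hence "padic_abs p (X n) > a" "padic_abs p (Y n) > b" using i j by auto
    hence "X n \<noteq> 0" "Y n \<noteq> 0" using a b by auto
    hence "inverse (X n) - inverse (Y n) = - (inverse (X n) * inverse (Y n)) * (X n - Y n)"
      using inverse_diff_inverse[of "X n" "Y n"] by (simp add: mult.assoc mult.commute)
    thus "padic_abs p (- (inverse (X n) * inverse (Y n)) * (X n - Y n)) =
      padic_abs p (inverse (X n) - inverse (Y n))"
      by simp
  qed
  ultimately show ?thesis
    unfolding padic_null_def by (rule Lim_transform_eventually)
qed

lemma part_equivp_padic_rel: "part_equivp (padic_rel p)"
proof (rule part_equivpI)
  show "\<exists>X. padic_rel p X X"
    by (rule exI[of _ "\<lambda>n. 0"]) (simp add: padic_rel_def padic_Cauchy_const padic_null_const)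
  show "symp (padic_rel p)"
    by (rule sympI) (auto simp: padic_rel_def padic_null_def padic_abs_minus_commute)
  show "transp (padic_rel p)"
  proof (rule transpI)
    fix X Y Z assume "padic_rel p X Y" "padic_rel p Y Z"
    thus "padic_rel p X Z"
      using padic_null_add[of "\<lambda>n. X n - Y n" "\<lambda>n. Y n - Z n"] by (simp add: padic_rel_def)
  qed
qed

lemma padic_rel_null_iff: 
  assumes "padic_rel p X Y" shows "padic_null p X \<longleftrightarrow> padic_null p Y"
proof -
  have XY: "padic_null p (\<lambda>n. X n - Y n)" using assms by (simp add: padic_rel_def)
  show ?thesis
    using padic_null_diff[OF _ XY, of X] padic_null_add[OF _ XY, of Y] by auto
qed

lemma padic_rel_abs_lim:
  assumes "padic_rel p X Y"
  shows "lim (\<lambda>n. padic_abs p (X n)) = lim (\<lambda>n. padic_abs p (Y n))"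
proof -
  obtain L where L: "(\<lambda>n. padic_abs p (Y n)) \<longlonglongrightarrow> L"
    using assms padic_Cauchy_abs_convergent[of Y] by (auto simp: padic_rel_def convergent_def)
  have "(\<lambda>n. padic_abs p (X n) - padic_abs p (Y n)) \<longlonglongrightarrow> 0"
  proof (rule tendsto_rabs_zero_cancel, rule tendsto_sandwich[OF _ _ tendsto_const])
    show "(\<lambda>n. padic_abs p (X n - Y n)) \<longlonglongrightarrow> 0"
      using assms by (simp add: padic_rel_def padic_null_def)
  qed (auto simp: padic_abs_diff_triangle[OF p])
  hence "(\<lambda>n. padic_abs p (X n)) \<longlonglongrightarrow> L"
    using tendsto_add[OF _ L] by fastforce
  thus ?thesis using L limI by metis
qed

end


section \<open>The field of \<open>p\<close>-adic numbers\<close>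

text \<open>
  The prime \<open>p\<close> is carried by the type: \<open>'p padic\<close> is \<open>\<rat>\<^sub>p\<close> for \<open>p = CARD('p)\<close>, constructed as the
  completion of \<open>\<rat>\<close> with respect to the \<open>p\<close>-adic absolute value.
\<close>

typedef ('p::prime_card) padic =
  "{C. \<exists>X. padic_rel CARD('p) X X \<and> C = Collect (padic_rel CARD('p) X)}"
  morphisms padic_class Abs_padic_class
proof -
  have "padic_rel CARD('p) (\<lambda>_. 0) (\<lambda>_. 0)"
    by (simp add: padic_rel_def padic_Cauchy_const[OF prime_card] padic_null_const[OF prime_card])
  thus ?thesis by blast
qed

definition abs_padic :: "(nat \<Rightarrow> rat) \<Rightarrow> 'p::prime_card padic" where
  "abs_padic X = Abs_padic_class (Collect (padic_rel CARD('p) X))"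

definition rep_padic :: "'p::prime_card padic \<Rightarrow> nat \<Rightarrow> rat" where
  "rep_padic x = (SOME X. X \<in> padic_class x)"

definition cr_padic :: "(nat \<Rightarrow> rat) \<Rightarrow> 'p::prime_card padic \<Rightarrow> bool" where
  "cr_padic = (\<lambda>X x. padic_rel CARD('p) X X \<and> abs_padic X = x)"

lemma Quotient_padic:
  "Quotient (padic_rel CARD('p)) abs_padic rep_padic (cr_padic :: _ \<Rightarrow> 'p::prime_card padic \<Rightarrow> bool)"
proof -
  let ?R = "padic_rel CARD('p)"
  interpret quot_type ?R "Abs_padic_class :: _ \<Rightarrow> 'p padic" padic_class
  proof
    show "part_equivp ?R" by (rule part_equivp_padic_rel[OF prime_card])
    show "\<exists>X. ?R X X \<and> padic_class y = Collect (?R X)" for y :: "'p padic"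
      using padic_class[of y] by simp
    show "Abs_padic_class (padic_class x) = x" for x :: "'p padic"
      by (rule padic_class_inverse)
    show "padic_class (Abs_padic_class C :: 'p padic) = C"
      if "\<exists>X. ?R X X \<and> C = Collect (?R X)" for C
      using that by (intro Abs_padic_class_inverse) simp
    show "padic_class x = padic_class y \<longleftrightarrow> x = y" for x y :: "'p padic"
      by (rule padic_class_inject)
  qed
  have "abs_padic = (abs :: _ \<Rightarrow> 'p padic)" "rep_padic = rep"
    by (simp_all add: fun_eq_iff abs_padic_def abs_def rep_padic_def rep_def)
  hence "Quotient3 ?R (abs_padic :: _ \<Rightarrow> 'p padic) rep_padic"
    using Quotient by simp
  thus ?thesis by (rule Quotient3_to_Quotient) (simp add: cr_padic_def)
qed

setup_lifting Quotient_padic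

instantiation padic :: (prime_card) field
begin

lift_definition zero_padic :: "'a padic" is "\<lambda>n. 0"
  by (simp add: padic_rel_def padic_Cauchy_const[OF prime_card] padic_null_const[OF prime_card])

lift_definition one_padic :: "'a padic" is "\<lambda>n. 1"
  by (simp add: padic_rel_def padic_Cauchy_const[OF prime_card] padic_null_const[OF prime_card])

lift_definition plus_padic :: "'a padic \<Rightarrow> 'a padic \<Rightarrow> 'a padic" is "\<lambda>X Y n. X n + Y n"
  unfolding padic_rel_def add_diff_add
  by (simp add: padic_Cauchy_add[OF prime_card] padic_null_add[OF prime_card])

lift_definition uminus_padic :: "'a padic \<Rightarrow> 'a padic" is "\<lambda>X n. - X n"
  unfolding padic_rel_def minus_diff_minus
  by (simp only: padic_Cauchy_minus[OF prime_card] padic_null_minus[OF prime_card] simp_thms)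

lift_definition times_padic :: "'a padic \<Rightarrow> 'a padic \<Rightarrow> 'a padic" is "\<lambda>X Y n. X n * Y n"
proof -
  fix X X' Y Y' :: "nat \<Rightarrow> rat"
  let ?p = "CARD('a)"
  assume *: "padic_rel ?p X X'" "padic_rel ?p Y Y'"
  obtain A where A: "\<And>n. padic_abs ?p (X n) \<le> A"
    using * padic_Cauchy_bounded[OF prime_card, of X] by (auto simp: padic_rel_def)
  obtain B where B: "\<And>n. padic_abs ?p (Y' n) \<le> B"
    using * padic_Cauchy_bounded[OF prime_card, of Y'] by (auto simp: padic_rel_def)
  have "padic_null ?p (\<lambda>n. X n * (Y n - Y' n) + Y' n * (X n - X' n))"
    using * A B
    by (intro padic_null_add[OF prime_card] padic_null_mult_bounded[OF prime_card])
       (auto simp: padic_rel_def)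
  moreover have "(\<lambda>n. X n * (Y n - Y' n) + Y' n * (X n - X' n)) = (\<lambda>n. X n * Y n - X' n * Y' n)"
    by (simp add: fun_eq_iff algebra_simps)
  ultimately show "padic_rel ?p (\<lambda>n. X n * Y n) (\<lambda>n. X' n * Y' n)"
    using * by (simp add: padic_rel_def padic_Cauchy_mult[OF prime_card])
qed

lift_definition inverse_padic :: "'a padic \<Rightarrow> 'a padic"
  is "\<lambda>X. if padic_null CARD('a) X then (\<lambda>n. 0) else (\<lambda>n. inverse (X n))"
proof -
  fix X Y :: "nat \<Rightarrow> rat"
  let ?p = "CARD('a)"
  assume *: "padic_rel ?p X Y"
  note iff = padic_rel_null_iff[OF prime_card *]
  show "padic_rel ?p (if padic_null ?p X then (\<lambda>n. 0) else (\<lambda>n. inverse (X n)))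
                     (if padic_null ?p Y then (\<lambda>n. 0) else (\<lambda>n. inverse (Y n)))"
    using * iff padic_null_diff_inverse[OF prime_card, of X Y]
    by (auto simp: padic_rel_def padic_Cauchy_inverse[OF prime_card]
        padic_Cauchy_const[OF prime_card] padic_null_const[OF prime_card])
qed

definition minus_padic :: "'a padic \<Rightarrow> 'a padic \<Rightarrow> 'a padic" where
  "minus_padic x y = x + - y"

definition divide_padic :: "'a padic \<Rightarrow> 'a padic \<Rightarrow> 'a padic" where
  "divide_padic x y = x * inverse y"

instance
proof
  fix a b c :: "'a padic"
  note [simp] = padic_rel_def padic_null_const[OF prime_card] padic_Cauchy_const[OF prime_card]
    padic_Cauchy_add[OF prime_card] padic_Cauchy_mult[OF prime_card]
    padic_Cauchy_minus[OF prime_card]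
  show "a + b + c = a + (b + c)" by transfer (simp add: ac_simps)
  show "a + b = b + a" by transfer (simp add: ac_simps)
  show "0 + a = a" by transfer simp
  show "- a + a = 0" by transfer simp
  show "a - b = a + - b" by (rule minus_padic_def)
  show "a * b * c = a * (b * c)" by transfer (simp add: ac_simps)
  show "a * b = b * a" by transfer (simp add: ac_simps)
  show "1 * a = a" by transfer simp
  show "(a + b) * c = a * c + b * c" by transfer (simp add: distrib_right)
  show "(0::'a padic) \<noteq> 1" by transfer simp
  show "a div b = a * inverse b" by (rule divide_padic_def)
  show "inverse (0::'a padic) = 0" by transfer simp
  have inv: "padic_null CARD('a) (\<lambda>n. inverse (X n) * X n - 1)"
    if X: "padic_Cauchy CARD('a) X" "\<not> padic_null CARD('a) X" for X
  proof -
    obtain b k where b: "b > 0" and k: "\<And>n. n \<ge> k \<Longrightarrow> padic_abs CARD('a) (X n) > b"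
      using padic_Cauchy_not_null[OF prime_card X] by metis
    have "\<forall>\<^sub>F n in sequentially. padic_abs CARD('a) (inverse (X n) * X n - 1) = 0"
    proof (rule eventually_sequentiallyI[of k])
      fix n assume "n \<ge> k"
      hence "X n \<noteq> 0" using k[of n] b by auto
      thus "padic_abs CARD('a) (inverse (X n) * X n - 1) = 0" by simp
    qed
    thus ?thesis unfolding padic_null_def by (rule tendsto_eventually)
  qed
  show "a \<noteq> 0 \<Longrightarrow> inverse a * a = 1"
    by transfer (auto simp: inv padic_Cauchy_inverse[OF prime_card])
qed

end

lemma padic_rel_refl_iff: "prime p \<Longrightarrow> padic_rel p X X \<longleftrightarrow> padic_Cauchy p X"
  by (simp add: padic_rel_def padic_null_const)

lemma abs_padic_eq_iff:
  assumes "padic_Cauchy CARD('p) X" "padic_Cauchy CARD('p) Y"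
  shows "abs_padic X = (abs_padic Y :: 'p::prime_card padic) \<longleftrightarrow> padic_null CARD('p) (\<lambda>n. X n - Y n)"
  using assms Quotient_rel[OF Quotient_padic[where 'p = 'p], of X Y]
  by (auto simp: padic_rel_refl_iff[OF prime_card]) (auto simp: padic_rel_def)

lemma abs_padic_of_nat: "(of_nat n :: 'p::prime_card padic) = abs_padic (\<lambda>_. of_nat n)"
proof (induction n)
  case 0
  show ?case by (simp add: zero_padic.abs_eq)
next
  case (Suc n)
  have "(of_nat (Suc n) :: 'p padic) = abs_padic (\<lambda>_. 1) + abs_padic (\<lambda>_. of_nat n)"
    using Suc by (simp add: one_padic.abs_eq)
  also have "\<dots> = abs_padic (\<lambda>_. of_nat (Suc n))"
    by (subst plus_padic.abs_eq)
       (simp_all add: eq_onp_def padic_rel_refl_iff[OF prime_card] padic_Cauchy_const[OF prime_card])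
  finally show ?case .
qed

instance padic :: (prime_card) field_char_0
proof
  show "inj (of_nat :: nat \<Rightarrow> 'a padic)"
  proof (rule injI)
    fix m n :: nat assume "(of_nat m :: 'a padic) = of_nat n"
    hence "abs_padic (\<lambda>_. of_nat m) = (abs_padic (\<lambda>_. of_nat n) :: 'a padic)"
      by (simp add: abs_padic_of_nat)
    thus "m = n"
      by (simp add: abs_padic_eq_iff padic_Cauchy_const[OF prime_card] padic_null_const[OF prime_card])
  qed
qed


section \<open>The \<open>p\<close>-adic norm and its topology\<close>

lift_definition padic_norm :: "'p::prime_card padic \<Rightarrow> real" is "\<lambda>X. lim (\<lambda>n. padic_abs CARD('p) (X n))"
  by (rule padic_rel_abs_lim[OF prime_card])

lemma padic_norm_LIMSEQ:
  assumes "padic_Cauchy CARD('p::prime_card) X"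
  shows "(\<lambda>n. padic_abs CARD('p) (X n)) \<longlonglongrightarrow> padic_norm (abs_padic X :: 'p padic)"
  using assms padic_Cauchy_abs_convergent[OF prime_card assms]
  by (simp add: padic_norm.abs_eq padic_rel_refl_iff[OF prime_card] convergent_LIMSEQ_iff)

lemma padic_cases:
  obtains X where "x = (abs_padic X :: 'p::prime_card padic)" "padic_Cauchy CARD('p) X"
  using Quotient_abs_rep[OF Quotient_padic, of x] Quotient_rep_reflp[OF Quotient_padic, of x]
  by (metis padic_rel_refl_iff[OF prime_card])

lemma padic_norm_nonneg [simp]: "padic_norm (x :: 'p::prime_card padic) \<ge> 0"
proof (cases x rule: padic_cases)
  case (1 X)
  show ?thesis unfolding 1(1) by (rule LIMSEQ_le_const[OF padic_norm_LIMSEQ[OF 1(2)]]) auto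
qed

lemma padic_norm_eq_0_iff [simp]: "padic_norm x = 0 \<longleftrightarrow> x = (0 :: 'p::prime_card padic)"
proof (cases x rule: padic_cases)
  case (1 X)
  have "padic_norm x = 0 \<longleftrightarrow> padic_null CARD('p) X"
    unfolding 1(1) padic_null_def using padic_norm_LIMSEQ[OF 1(2)] LIMSEQ_unique by metis
  also have "\<dots> \<longleftrightarrow> x = 0"
    using 1 by (simp add: zero_padic.abs_eq abs_padic_eq_iff padic_Cauchy_const[OF prime_card])
  finally show ?thesis .
qed

lemma padic_norm_mult: "padic_norm (x * y) = padic_norm x * padic_norm (y :: 'p::prime_card padic)"
proof (cases x rule: padic_cases)
  case (1 X)
  show ?thesis
  proof (cases y rule: padic_cases)
    case Y: (1 Y)
    have "x * y = abs_padic (\<lambda>n. X n * Y n)"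
      using 1 Y by (simp add: times_padic.abs_eq padic_rel_refl_iff[OF prime_card])
    hence "(\<lambda>n. padic_abs CARD('p) (X n) * padic_abs CARD('p) (Y n)) \<longlonglongrightarrow> padic_norm (x * y)"
      using padic_norm_LIMSEQ[OF padic_Cauchy_mult[OF prime_card 1(2) Y(2)]]
      by (simp add: padic_abs_mult[OF prime_card])
    moreover have "(\<lambda>n. padic_abs CARD('p) (X n) * padic_abs CARD('p) (Y n)) \<longlonglongrightarrow> padic_norm x * padic_norm y"
      unfolding 1(1) Y(1) by (intro tendsto_mult padic_norm_LIMSEQ 1 Y)
    ultimately show ?thesis by (rule LIMSEQ_unique)
  qed
qed

lemma padic_norm_minus [simp]: "padic_norm (- x) = padic_norm (x :: 'p::prime_card padic)"
proof (cases x rule: padic_cases)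
  case (1 X)
  have "- x = abs_padic (\<lambda>n. - X n)"
    using 1 by (simp add: uminus_padic.abs_eq padic_rel_refl_iff[OF prime_card])
  hence "(\<lambda>n. padic_abs CARD('p) (X n)) \<longlonglongrightarrow> padic_norm (- x)"
    using padic_norm_LIMSEQ[OF padic_Cauchy_minus[OF prime_card 1(2)]] by simp
  thus ?thesis using padic_norm_LIMSEQ[OF 1(2)] 1(1) LIMSEQ_unique by blast
qed

lemma padic_norm_ultrametric: "padic_norm (x + y) \<le> max (padic_norm x) (padic_norm (y :: 'p::prime_card padic))"
proof (cases x rule: padic_cases)
  case (1 X)
  show ?thesis
  proof (cases y rule: padic_cases)
    case Y: (1 Y)
    have "x + y = abs_padic (\<lambda>n. X n + Y n)"
      using 1 Y by (simp add: plus_padic.abs_eq padic_rel_refl_iff[OF prime_card])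
    hence L: "(\<lambda>n. padic_abs CARD('p) (X n + Y n)) \<longlonglongrightarrow> padic_norm (x + y)"
      using padic_norm_LIMSEQ[OF padic_Cauchy_add[OF prime_card 1(2) Y(2)]] by simp
    have R: "(\<lambda>n. max (padic_abs CARD('p) (X n)) (padic_abs CARD('p) (Y n))) \<longlonglongrightarrow> max (padic_norm x) (padic_norm y)"
      unfolding 1(1) Y(1) by (intro tendsto_max padic_norm_LIMSEQ 1 Y)
    show ?thesis by (rule LIMSEQ_le[OF L R]) (use padic_abs_ultrametric[OF prime_card] in blast)
  qed
qed

instantiation padic :: (prime_card) metric_space
begin

definition dist_padic :: "'a padic \<Rightarrow> 'a padic \<Rightarrow> real" where
  "dist_padic x y = padic_norm (x - y)"

definition uniformity_padic :: "('a padic \<times> 'a padic) filter" where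
  "uniformity_padic = (INF e\<in>{0<..}. principal {(x, y). dist x y < e})"

definition open_padic :: "'a padic set \<Rightarrow> bool" where
  "open_padic U \<longleftrightarrow> (\<forall>x\<in>U. \<forall>\<^sub>F (x', y) in uniformity. x' = x \<longrightarrow> y \<in> U)"

instance
proof
  fix x y z :: "'a padic"
  show "dist x y = 0 \<longleftrightarrow> x = y" by (simp add: dist_padic_def)
  have "dist x y = padic_norm ((x - z) + - (y - z))" by (simp add: dist_padic_def)
  also have "\<dots> \<le> max (padic_norm (x - z)) (padic_norm (- (y - z)))" by (rule padic_norm_ultrametric)
  also have "\<dots> \<le> dist x z + dist y z"
    unfolding padic_norm_minus dist_padic_def
    using padic_norm_nonneg[of "x - z"] padic_norm_nonneg[of "y - z"] by linarith
  finally show "dist x y \<le> dist x z + dist y z" .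
qed (simp_all add: uniformity_padic_def open_padic_def)

end

lemma padic_norm_of_nat: "padic_norm (of_nat n :: 'p::prime_card padic) = padic_abs CARD('p) (of_nat n)"
  using padic_norm_LIMSEQ[OF padic_Cauchy_const[OF prime_card], where 'p = 'p]
  by (simp add: abs_padic_of_nat LIMSEQ_const_iff)

lemma abs_padic_of_rat: "(of_rat r :: 'p::prime_card padic) = abs_padic (\<lambda>_. r)"
proof -
  have rf: "padic_rel CARD('p) (\<lambda>_. s) (\<lambda>_. s)" for s
    by (simp add: padic_rel_refl_iff[OF prime_card] padic_Cauchy_const[OF prime_card])
  have oi: "(of_int k :: 'p padic) = abs_padic (\<lambda>_. of_int k)" for k
    by (cases k rule: int_cases2) (simp_all add: abs_padic_of_nat uminus_padic.abs_eq[OF rf])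
  obtain a b where r: "r = Fract a b" "b > 0" using Rat_cases by metis
  have "abs_padic (\<lambda>_. r) * (of_int b :: 'p padic) = of_int a"
    using r by (simp add: oi times_padic.abs_eq[OF rf rf] Fract_of_int_quotient)
  thus ?thesis using r by (simp add: of_rat_rat field_simps)
qed

lemma padic_norm_of_rat: "padic_norm (of_rat r :: 'p::prime_card padic) = padic_abs CARD('p) r"
  using padic_norm_LIMSEQ[OF padic_Cauchy_const[OF prime_card], where 'p = 'p]
  by (simp add: abs_padic_of_rat LIMSEQ_const_iff)

lemma abs_padic_LIMSEQ:
  assumes X: "padic_Cauchy CARD('p::prime_card) X"
  shows "(\<lambda>n. of_rat (X n)) \<longlonglongrightarrow> (abs_padic X :: 'p padic)"
proof (rule metric_LIMSEQ_I)
  fix e :: real assume e: "e > 0"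
  let ?p = "CARD('p)"
  obtain M where M: "\<forall>m\<ge>M. \<forall>n\<ge>M. padic_abs ?p (X m - X n) < e / 2"
    using X e unfolding padic_Cauchy_def by (metis half_gt_zero)
  have "dist (of_rat (X m)) (abs_padic X :: 'p padic) < e" if m: "m \<ge> M" for m
  proof -
    have C: "padic_Cauchy ?p (\<lambda>n. X m + - X n)"
      by (intro padic_Cauchy_add[OF prime_card] padic_Cauchy_const[OF prime_card]
          padic_Cauchy_minus[OF prime_card] X)
    have "of_rat (X m) - (abs_padic X :: 'p padic) = abs_padic (\<lambda>n. X m + - X n)"
      using X by (simp add: minus_padic_def abs_padic_of_rat uminus_padic.abs_eq plus_padic.abs_eq
          padic_rel_refl_iff[OF prime_card] padic_Cauchy_const[OF prime_card]
          padic_Cauchy_minus[OF prime_card])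
    hence "(\<lambda>n. padic_abs ?p (X m + - X n)) \<longlonglongrightarrow> dist (of_rat (X m)) (abs_padic X :: 'p padic)"
      using padic_norm_LIMSEQ[OF C] by (simp add: dist_padic_def)
    moreover have "\<exists>N. \<forall>n\<ge>N. padic_abs ?p (X m + - X n) \<le> e / 2"
      using M m by (intro exI[of _ M]) (auto intro: less_imp_le)
    ultimately have "dist (of_rat (X m)) (abs_padic X :: 'p padic) \<le> e / 2"
      by (rule LIMSEQ_le_const2)
    thus ?thesis using e by simp
  qed
  thus "\<exists>M. \<forall>m\<ge>M. dist (of_rat (X m)) (abs_padic X :: 'p padic) < e" by blast
qed

lemma of_rat_dense_padic:
  fixes x :: "'p::prime_card padic"
  assumes "e > 0"
  obtains r where "dist x (of_rat r) < e"
proof (cases x rule: padic_cases)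
  case (1 X)
  thus ?thesis
    using metric_LIMSEQ_D[OF abs_padic_LIMSEQ[OF 1(2)] assms] that by (metis dist_commute order_refl)
qed

instance padic :: (prime_card) complete_space
proof
  fix X :: "nat \<Rightarrow> 'a padic"
  assume X: "Cauchy X"
  let ?p = "CARD('a)"
  have "\<exists>r. dist (X n) (of_rat r) < inverse (real (Suc n))" for n
    using of_rat_dense_padic[of "inverse (real (Suc n))" "X n"] by auto
  then obtain r where r: "\<And>n. dist (X n) (of_rat (r n)) < inverse (real (Suc n))" by metis
  have close: "(\<lambda>n. dist (X n) (of_rat (r n) :: 'a padic)) \<longlonglongrightarrow> 0"
  proof (rule tendsto_sandwich[OF _ _ tendsto_const LIMSEQ_inverse_real_of_nat])
    show "\<forall>\<^sub>F n in sequentially. dist (X n) (of_rat (r n)) \<le> inverse (real (Suc n))"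
      by (intro always_eventually allI less_imp_le r)
  qed simp
  have "padic_Cauchy ?p r"
    unfolding padic_Cauchy_def
  proof (intro allI impI)
    fix e :: real assume e: "e > 0"
    obtain M where M: "\<forall>m\<ge>M. \<forall>n\<ge>M. dist (X m) (X n) < e / 3"
      using metric_CauchyD[OF X, of "e / 3"] e by auto
    obtain N where N: "\<forall>n\<ge>N. dist (X n) (of_rat (r n) :: 'a padic) < e / 3"
      using order_tendstoD(2)[OF close, of "e / 3"] e by (auto simp: eventually_sequentially)
    have "padic_abs ?p (r m - r n) < e" if mn: "m \<ge> max M N" "n \<ge> max M N" for m n
    proof -
      have "padic_abs ?p (r m - r n) = dist (of_rat (r m)) (of_rat (r n) :: 'a padic)"
        by (simp add: dist_padic_def padic_norm_of_rat[symmetric] of_rat_diff)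
      also have "\<dots> \<le> dist (X m) (of_rat (r m)) + dist (X m) (of_rat (r n))"
        by (rule dist_triangle3)
      also have "\<dots> \<le> dist (X m) (of_rat (r m)) + (dist (X m) (X n) + dist (X n) (of_rat (r n)))"
        by (intro add_left_mono dist_triangle)
      also have "\<dots> < e / 3 + (e / 3 + e / 3)"
        using M N mn by (intro add_strict_mono) auto
      also have "\<dots> = e" by simp
      finally show ?thesis .
    qed
    thus "\<exists>M. \<forall>m\<ge>M. \<forall>n\<ge>M. padic_abs ?p (r m - r n) < e" by blast
  qed
  hence L: "(\<lambda>n. of_rat (r n)) \<longlonglongrightarrow> (abs_padic r :: 'a padic)" by (rule abs_padic_LIMSEQ)
  have "(\<lambda>n. dist (X n) (abs_padic r)) \<longlonglongrightarrow> 0"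
  proof (rule tendsto_sandwich[OF _ _ tendsto_const])
    show "(\<lambda>n. dist (X n) (of_rat (r n)) + dist (of_rat (r n)) (abs_padic r :: 'a padic)) \<longlonglongrightarrow> 0"
      using tendsto_add[OF close L[THEN tendsto_dist_iff[THEN iffD1]]] by simp
    show "\<forall>\<^sub>F n in sequentially. dist (X n) (abs_padic r) \<le>
        dist (X n) (of_rat (r n)) + dist (of_rat (r n)) (abs_padic r :: 'a padic)"
      by (intro always_eventually allI dist_triangle)
  qed simp
  hence "X \<longlonglongrightarrow> abs_padic r" by (rule tendsto_dist_iff[THEN iffD2])
  thus "convergent X" by (auto simp: convergent_def)
qed

lifting_forget padic.lifting


section \<open>Fermionic integration and \<open>p\<close>-adic trigonometric functions\<close>

definition padic_integers :: "'p::prime_card padic set" where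
  "padic_integers = {x. padic_norm x \<le> 1}"

definition strictly_differentiable_on ::
  "'p::prime_card padic set \<Rightarrow> ('p padic \<Rightarrow> 'p padic) \<Rightarrow> bool" where
  "strictly_differentiable_on S f \<longleftrightarrow> (\<forall>z\<in>S. \<exists>l.
     ((\<lambda>(x, y). (f x - f y) / (x - y)) \<longlongrightarrow> l)
       (at (z, z) within {(x, y). x \<in> S \<and> y \<in> S \<and> x \<noteq> y}))"

text \<open>
  As \<open>(has_integral)\<close> in the library: the integrand lies in \<open>C\<^sup>(\<^sup>1\<^sup>)(\<int>\<^sub>p)\<close>, the defining limit exists, and
  its value is \<open>I\<close>. Only the values of \<open>f\<close> on \<open>\<int>\<^sub>p\<close> matter.
\<close>

definition has_fermionic_integral ::
  "('p::prime_card padic \<Rightarrow> 'p padic) \<Rightarrow> 'p padic \<Rightarrow> bool" where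
  "has_fermionic_integral f I \<longleftrightarrow>
     strictly_differentiable_on padic_integers f \<and>
     (\<lambda>N. \<Sum>x<CARD('p) ^ N. f (of_nat x) * (-1) ^ x) \<longlonglongrightarrow> I"

definition padic_cos_term :: "'p::prime_card padic \<Rightarrow> nat \<Rightarrow> 'p padic" where
  "padic_cos_term x n = (-1) ^ n * x ^ (2 * n) / fact (2 * n)"

definition padic_sin_term :: "'p::prime_card padic \<Rightarrow> nat \<Rightarrow> 'p padic" where
  "padic_sin_term x n = (-1) ^ n * x ^ (2 * n + 1) / fact (2 * n + 1)"

text \<open>
  These series do not converge everywhere on \<open>\<int>\<^sub>p\<close> (they diverge at units); outside the following set
  the values of \<open>padic_cos\<close> and \<open>padic_sin\<close> are meaningless.
\<close>

definition padic_trig_domain :: "'p::prime_card padic set" where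
  "padic_trig_domain = {x. summable (padic_cos_term x) \<and> summable (padic_sin_term x)}"

definition padic_cos :: "'p::prime_card padic \<Rightarrow> 'p padic" where
  "padic_cos x = (\<Sum>n. padic_cos_term x n)"

definition padic_sin :: "'p::prime_card padic \<Rightarrow> 'p padic" where
  "padic_sin x = (\<Sum>n. padic_sin_term x n)"

definition padic_tan :: "'p::prime_card padic \<Rightarrow> 'p padic" where
  "padic_tan x = padic_sin x / padic_cos x"

end

theory Submission
  imports Defs
begin

text \<open>
  Convergence of the cosine series at \<open>a\<close> forces \<open>\<bar>a\<bar> < 1\<close>, hence \<open>\<bar>a\<bar> \<le> 1/p\<close>. On this disc the addition
  formulas hold by the ultrametric Cauchy product. Put \<open>c = cos a\<close>, \<open>s = sin a\<close> and let \<open>T\<close>, \<open>U\<close> be the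
  alternating sums of \<open>cos (a x)\<close> and \<open>sin (a x)\<close> over \<open>x < M = p\<^sup>N\<close>. Since \<open>M\<close> is odd, telescoping
  \<open>(f (x + 1) + f x) (-1)\<^sup>x\<close> for \<open>f = cos (a x)\<close> and \<open>f = sin (a x)\<close> gives
  \<open>(c + 1) T - s U = 1 + cos (a M)\<close> and \<open>(c + 1) U + s T = sin (a M)\<close>. The determinant of this linear system
  is \<open>2 (c + 1) \<noteq> 0\<close>, and the right-hand sides tend to \<open>2\<close> and \<open>0\<close> because \<open>M\<close> tends to \<open>0\<close> in \<open>\<int>\<^sub>p\<close>.
  Strict differentiability comes from the second-order bounds \<open>\<bar>cos h - 1\<bar> \<le> \<bar>h\<bar>\<^sup>2\<close> and
  \<open>\<bar>sin h - h\<bar> \<le> \<bar>h\<bar>\<^sup>2\<close> through the addition formulas.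
\<close>

section \<open>Ultrametric analysis\<close>

lemma padic_norm_0 [simp]: "padic_norm (0 :: 'p::prime_card padic) = 0"
  by simp

lemma padic_norm_triangle: "padic_norm (x + y) \<le> padic_norm x + padic_norm (y :: 'p::prime_card padic)"
  using padic_norm_ultrametric[of x y] padic_norm_nonneg[of x] padic_norm_nonneg[of y] by linarith

lemma padic_norm_add_le:
  "padic_norm x \<le> B \<Longrightarrow> padic_norm y \<le> B \<Longrightarrow> padic_norm (x + y :: 'p::prime_card padic) \<le> B"
  using padic_norm_ultrametric[of x y] by linarith

lemma padic_norm_diff_le:
  "padic_norm x \<le> B \<Longrightarrow> padic_norm y \<le> B \<Longrightarrow> padic_norm (x - y :: 'p::prime_card padic) \<le> B"
  using padic_norm_add_le[of x B "- y"] by simp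

lemma padic_norm_sum_le:
  fixes f :: "'a \<Rightarrow> 'p::prime_card padic"
  assumes "\<And>x. x \<in> A \<Longrightarrow> padic_norm (f x) \<le> B" "B \<ge> 0"
  shows "padic_norm (sum f A) \<le> B"
  using assms by (induction A rule: infinite_finite_induct) (auto intro!: padic_norm_add_le)

lemma padic_norm_1 [simp]: "padic_norm (1 :: 'p::prime_card padic) = 1"
  using padic_norm_of_rat[of 1, where 'p = 'p] by simp

lemma padic_norm_power: "padic_norm (x ^ n) = padic_norm (x :: 'p::prime_card padic) ^ n"
  by (induction n) (simp_all add: padic_norm_mult)

lemma padic_norm_inverse:
  "padic_norm (inverse x) = inverse (padic_norm (x :: 'p::prime_card padic))"
proof (cases "x = 0")
  case False
  hence "padic_norm (inverse x) * padic_norm x = 1"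
    by (simp flip: padic_norm_mult)
  thus ?thesis by (metis inverse_unique mult.commute)
qed auto

lemma padic_norm_divide:
  "padic_norm (x / y) = padic_norm x / padic_norm (y :: 'p::prime_card padic)"
  by (simp add: field_class.field_divide_inverse padic_norm_mult padic_norm_inverse)

lemma tendsto_padic_sandwich:
  fixes f :: "'a \<Rightarrow> 'p::prime_card padic"
  assumes "\<forall>\<^sub>F x in F. padic_norm (f x - l) \<le> g x" "(g \<longlongrightarrow> 0) F"
  shows "(f \<longlongrightarrow> l) F"
  by (rule tendsto_dist_iff[THEN iffD2], rule tendsto_sandwich[OF _ _ tendsto_const assms(2)])
     (use assms(1) in \<open>auto simp: dist_padic_def\<close>)

lemma tendsto_padic_norm_diff:
  fixes f :: "'a \<Rightarrow> 'p::prime_card padic"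
  assumes "(f \<longlongrightarrow> l) F"
  shows "((\<lambda>x. padic_norm (f x - l)) \<longlongrightarrow> 0) F"
  using tendsto_dist_iff[THEN iffD1, OF assms] by (simp add: dist_padic_def)

section \<open>Continuity of the field operations\<close>

lemma tendsto_fst_nhds: "(fst \<longlongrightarrow> a) (nhds a \<times>\<^sub>F G)"
  by (metis filterlim_def filtermap_fst_prod_filter)

lemma tendsto_snd_nhds: "(snd \<longlongrightarrow> b) (F \<times>\<^sub>F nhds b)"
  by (metis filterlim_def filtermap_snd_prod_filter)

text \<open>Together with the multiplicative instance below, this opens the generic rules for limits
  of sums, differences and products; norm estimates on the product filter prove both.\<close>

instance padic :: (prime_card) topological_ab_group_add
proof
  fix a b :: "'a padic"
  show "LIM x nhds a \<times>\<^sub>F nhds b. fst x + snd x :> nhds (a + b)"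
  proof (rule tendsto_padic_sandwich)
    show "((\<lambda>x. padic_norm (fst x - a) + padic_norm (snd x - b)) \<longlongrightarrow> 0) (nhds a \<times>\<^sub>F nhds b)"
      using tendsto_padic_norm_diff[OF tendsto_fst_nhds, of a "nhds b"]
        tendsto_padic_norm_diff[OF tendsto_snd_nhds, of b "nhds a"]
      by (rule tendsto_add_zero)
    have "padic_norm (x + y - (a + b)) \<le> padic_norm (x - a) + padic_norm (y - b)" for x y
      using padic_norm_triangle[of "x - a" "y - b"] by (simp add: algebra_simps)
    thus "\<forall>\<^sub>F x in nhds a \<times>\<^sub>F nhds b. padic_norm (fst x + snd x - (a + b)) \<le>
        padic_norm (fst x - a) + padic_norm (snd x - b)"
      by (intro always_eventually allI)
  qed
  show "(uminus \<longlongrightarrow> - a) (nhds a)"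
  proof (rule tendsto_padic_sandwich)
    show "((\<lambda>x. padic_norm (x - a)) \<longlongrightarrow> 0) (nhds a)"
      using tendsto_padic_norm_diff[OF filterlim_ident, of a] .
    have "padic_norm (- x - - a) = padic_norm (x - a)" for x
      using padic_norm_minus[of "x - a"] by simp
    thus "\<forall>\<^sub>F x in nhds a. padic_norm (- x - - a) \<le> padic_norm (x - a)" by simp
  qed
qed

instance padic :: (prime_card) topological_semigroup_mult
proof
  fix a b :: "'a padic"
  show "LIM x nhds a \<times>\<^sub>F nhds b. fst x * snd x :> nhds (a * b)"
  proof (rule tendsto_padic_sandwich)
    let ?g = "\<lambda>x. padic_norm (fst x - a) * padic_norm (snd x - b) +
      (padic_norm a * padic_norm (snd x - b) + padic_norm (fst x - a) * padic_norm b)"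
    note 1 = tendsto_padic_norm_diff[OF tendsto_fst_nhds, of a "nhds b"]
    note 2 = tendsto_padic_norm_diff[OF tendsto_snd_nhds, of b "nhds a"]
    show "(?g \<longlongrightarrow> 0) (nhds a \<times>\<^sub>F nhds b)"
      by (intro tendsto_add_zero tendsto_mult_zero tendsto_mult_left_zero tendsto_mult_right_zero 1 2)
    have "padic_norm (x * y - a * b) \<le> padic_norm (x - a) * padic_norm (y - b) +
      (padic_norm a * padic_norm (y - b) + padic_norm (x - a) * padic_norm b)" for x y
    proof -
      have "x * y - a * b = (x - a) * (y - b) + (a * (y - b) + (x - a) * b)"
        by (simp add: algebra_simps)
      thus ?thesis
        using padic_norm_triangle[of "(x - a) * (y - b)" "a * (y - b) + (x - a) * b"]
          padic_norm_triangle[of "a * (y - b)" "(x - a) * b"]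
        by (simp add: padic_norm_mult)
    qed
    thus "\<forall>\<^sub>F x in nhds a \<times>\<^sub>F nhds b. padic_norm (fst x * snd x - a * b) \<le> ?g x"
      by (intro always_eventually allI)
  qed
qed

section \<open>Series under the ultrametric inequality\<close>

lemma padic_sums_norm_le:
  fixes f :: "nat \<Rightarrow> 'p::prime_card padic"
  assumes "f sums s" "\<And>n. padic_norm (f n) \<le> B"
  shows "padic_norm s \<le> B"
proof -
  have "B \<ge> 0" using assms(2)[of 0] padic_norm_nonneg[of "f 0"] by linarith
  have "(\<lambda>n. dist (\<Sum>k<n. f k) 0) \<longlonglongrightarrow> dist s 0"
    using assms(1) unfolding sums_def by (intro tendsto_intros)
  moreover have "dist (\<Sum>k<n. f k) 0 \<le> B" for n
    using \<open>B \<ge> 0\<close> assms(2) by (auto simp: dist_padic_def intro!: padic_norm_sum_le)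
  ultimately have "dist s 0 \<le> B" by (meson LIMSEQ_le_const2)
  thus ?thesis by (simp add: dist_padic_def)
qed

text \<open>No geometric tail has to be summed: a block of terms from \<open>n\<close> on is bounded
  by the largest of its bounds, \<open>r ^ n\<close>, so the partial sums are Cauchy.\<close>

lemma padic_summable_geometric:
  fixes f :: "nat \<Rightarrow> 'p::prime_card padic"
  assumes f: "\<And>n. padic_norm (f n) \<le> r ^ n" and r: "0 \<le> r" "r < 1"
  shows "summable f"
proof -
  have le: "dist (\<Sum>k<m. f k) (\<Sum>k<n. f k) \<le> r ^ n" if "n \<le> m" for m n
  proof -
    have "(\<Sum>k<m. f k) - (\<Sum>k<n. f k) = (\<Sum>k=n..<m. f k)"
      using that by (simp add: lessThan_atLeast0 sum_diff_nat_ivl)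
    moreover have "padic_norm (\<Sum>k=n..<m. f k) \<le> r ^ n"
    proof (rule padic_norm_sum_le)
      fix k assume "k \<in> {n..<m}"
      hence "r ^ k \<le> r ^ n" using r by (intro power_decreasing) auto
      thus "padic_norm (f k) \<le> r ^ n" using f[of k] by linarith
    qed (use r in auto)
    ultimately show ?thesis by (simp add: dist_padic_def)
  qed
  have "Cauchy (\<lambda>n. \<Sum>k<n. f k)"
  proof (rule metric_CauchyI)
    fix e :: real assume e: "e > 0"
    have "(\<lambda>n. r ^ n) \<longlonglongrightarrow> 0" using r by (intro LIMSEQ_realpow_zero) auto
    then obtain N where N: "r ^ N < e"
      using e order_tendstoD(2)[of "\<lambda>n. r ^ n" 0 sequentially e]
      by (auto simp: eventually_sequentially)
    have small: "dist (\<Sum>k<m. f k) (\<Sum>k<n. f k) < e" if "N \<le> n" "n \<le> m" for m n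
    proof -
      have "r ^ n \<le> r ^ N" using r that by (intro power_decreasing) auto
      thus ?thesis using le[OF that(2)] N by linarith
    qed
    show "\<exists>M. \<forall>m\<ge>M. \<forall>n\<ge>M. dist (\<Sum>k<m. f k) (\<Sum>k<n. f k) < e"
      using small by (metis dist_commute nle_le)
  qed
  thus ?thesis by (simp add: summable_iff_convergent Cauchy_convergent)
qed

text \<open>The partial sum \<open>P n\<close> runs over the triangle \<open>i + j < n\<close>, the
  product \<open>A n\<close> over the square containing it. Each term in between has
  \<open>i + j >= n\<close>, hence norm at most \<open>r ^ n\<close>, and so has their whole
  sum.\<close>

lemma padic_Cauchy_product_sums:
  fixes f g :: "nat \<Rightarrow> 'p::prime_card padic"
  assumes f: "f sums s" "\<And>n. padic_norm (f n) \<le> r ^ n"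
    and g: "g sums t" "\<And>n. padic_norm (g n) \<le> r ^ n"
    and r: "0 \<le> r" "r < 1"
  shows "(\<lambda>n. \<Sum>i\<le>n. f i * g (n - i)) sums (s * t)"
proof -
  define A where "A = (\<lambda>n. (\<Sum>i<n. f i) * (\<Sum>j<n. g j))"
  define P where "P = (\<lambda>n. \<Sum>k<n. \<Sum>i\<le>k. f i * g (k - i))"
  have lim: "A \<longlonglongrightarrow> s * t"
    using f(1) g(1) unfolding A_def sums_def by (intro tendsto_mult)
  have diff: "padic_norm (P n - A n) \<le> r ^ n" for n
  proof -
    let ?S = "{..<n} \<times> {..<n}" and ?T = "{(i, j). i + j < n}"
    let ?h = "\<lambda>(i, j). f i * g j"
    have "A n = sum ?h ?S"
      by (simp add: A_def sum_product sum.cartesian_product)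
    moreover have "P n = sum ?h ?T"
      unfolding P_def by (simp add: sum.triangle_reindex[of "\<lambda>i j. f i * g j"])
    moreover have "?T \<subseteq> ?S" by auto
    ultimately have "A n - P n = sum ?h (?S - ?T)"
      by (simp add: sum_diff)
    moreover have "padic_norm (sum ?h (?S - ?T)) \<le> r ^ n"
    proof (rule padic_norm_sum_le)
      fix x assume "x \<in> ?S - ?T"
      then obtain i j where x: "x = (i, j)" "n \<le> i + j" by auto
      have "padic_norm (?h x) \<le> r ^ i * r ^ j"
        using f(2) g(2) r by (auto simp: x padic_norm_mult intro!: mult_mono)
      also have "\<dots> \<le> r ^ n"
        using r x(2) by (simp flip: power_add add: power_decreasing)
      finally show "padic_norm (?h x) \<le> r ^ n" .
    qed (use r in auto)
    ultimately show ?thesis by (metis minus_diff_eq padic_norm_minus)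
  qed
  have "(\<lambda>n. P n - A n) \<longlonglongrightarrow> 0"
    by (rule tendsto_padic_sandwich[of _ _ "\<lambda>n. r ^ n"])
       (use diff r in \<open>auto intro!: always_eventually LIMSEQ_realpow_zero\<close>)
  from tendsto_add[OF this lim] show ?thesis
    by (simp add: sums_def P_def)
qed


section \<open>The size of factorials\<close>

lemma CARD_gt_1: "CARD('p::prime_card) > 1"
  by (rule prime_gt_1_nat[OF prime_card])

lemma padic_norm_of_nat_multiplicity:
  assumes "n \<noteq> 0"
  shows "padic_norm (of_nat n :: 'p::prime_card padic) = (1 / real CARD('p)) ^ multiplicity (int CARD('p)) (int n)"
proof -
  have "padic_norm (of_nat n :: 'p padic) = padic_abs CARD('p) (Fract (int n) 1)"
    by (simp add: padic_norm_of_nat of_nat_rat)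
  also have "\<dots> = real CARD('p) powi (- int (multiplicity (int CARD('p)) (int n)))"
    using assms by (simp add: padic_abs_Fract[OF prime_card])
  finally show ?thesis
    by (simp add: power_int_minus power_one_over inverse_eq_divide)
qed

lemma padic_norm_of_nat_le_1: "padic_norm (of_nat n :: 'p::prime_card padic) \<le> 1"
proof (cases "n = 0")
  case False
  thus ?thesis
    using CARD_gt_1[where 'p = 'p]
    by (auto simp: padic_norm_of_nat_multiplicity intro!: power_le_one)
qed simp

lemma padic_norm_fact_le_1: "padic_norm (fact n :: 'p::prime_card padic) \<le> 1"
  using padic_norm_of_nat_le_1[of "fact n", where 'p = 'p] by simp

lemma padic_norm_of_nat_unit:
  "\<not> CARD('p) dvd n \<Longrightarrow> padic_norm (of_nat n :: 'p::prime_card padic) = 1"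
  by (cases "n = 0") (simp_all add: padic_norm_of_nat_multiplicity not_dvd_imp_multiplicity_0)

text \<open>Since 2 is a unit, halving keeps the open unit disc and \<open>cos\<close> cannot reach
  \<open>-1\<close> there.\<close>

lemma padic_norm_2:
  assumes "odd CARD('p)"
  shows "padic_norm (2 :: 'p::prime_card padic) = 1"
proof -
  have "CARD('p) \<noteq> 2" using assms by auto
  hence "\<not> CARD('p) dvd 2" using CARD_gt_1[where 'p = 'p] by (auto dest!: dvd_imp_le)
  from padic_norm_of_nat_unit[OF this] show ?thesis by simp
qed

lemma padic_norm_of_nat_prime:
  "padic_norm (of_nat CARD('p) :: 'p::prime_card padic) = 1 / real CARD('p)"
  using CARD_gt_1[where 'p = 'p]
  by (subst padic_norm_of_nat_multiplicity) (auto simp: prime_card_int multiplicity_self)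

text \<open>The extra factors lie strictly between consecutive multiples of \<open>p\<close>, so
  they are units.\<close>

lemma padic_norm_fact_add:
  assumes "r < CARD('p::prime_card)"
  shows "padic_norm (fact (CARD('p) * m + r) :: 'p padic) = padic_norm (fact (CARD('p) * m) :: 'p padic)"
  using assms
proof (induction r)
  case (Suc r)
  have "\<not> CARD('p) dvd Suc r" using Suc.prems nat_dvd_not_less by blast
  hence "\<not> CARD('p) dvd CARD('p) * m + Suc r"
    by (metis dvd_add_right_iff dvd_triv_left)
  hence "padic_norm (of_nat (CARD('p) * m + Suc r) :: 'p padic) = 1"
    by (rule padic_norm_of_nat_unit)
  moreover have "fact (CARD('p) * m + Suc r) =
      (of_nat (CARD('p) * m + Suc r) :: 'p padic) * fact (CARD('p) * m + r)"
    by (simp only: add_Suc_right fact_Suc)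
  ultimately show ?case using Suc by (simp only: padic_norm_mult)
qed simp

lemma padic_norm_fact_mult:
  "padic_norm (fact (CARD('p) * m) :: 'p::prime_card padic) =
   (1 / real CARD('p)) ^ m * padic_norm (fact m :: 'p padic)"
proof (induction m)
  case (Suc m)
  let ?p = "CARD('p)"
  have p: "?p > 0" using CARD_gt_1[where 'p = 'p] by linarith
  \<comment> \<open>Splits off the one factor divisible by \<open>p\<close>; the
    \<open>p - 1\<close> factors before it are units by \<open>padic_norm_fact_add\<close>.\<close>
  have e: "?p * Suc m = Suc (?p * m + (?p - 1))" using p by simp
  have "(fact (?p * Suc m) :: 'p padic) = of_nat (?p * Suc m) * fact (?p * m + (?p - 1))"
    unfolding e by (rule fact_Suc)
  hence "padic_norm (fact (?p * Suc m) :: 'p padic) =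
      padic_norm (of_nat (?p * Suc m) :: 'p padic) * padic_norm (fact (?p * m) :: 'p padic)"
    using p padic_norm_fact_add[of "?p - 1" m, where 'p = 'p] by (simp add: padic_norm_mult del: mult_Suc_right of_nat_mult)
  also have "padic_norm (of_nat (?p * Suc m) :: 'p padic) =
      1 / real ?p * padic_norm (of_nat (Suc m) :: 'p padic)"
    by (simp only: of_nat_mult padic_norm_mult padic_norm_of_nat_prime)
  finally show ?case
    unfolding Suc by (simp only: fact_Suc padic_norm_mult power_Suc mult_ac)
qed simp

text \<open>Legendre's bound \<open>v\<^sub>p(n!) \<le> (n - 1) / (p - 1)\<close>, weakened by \<open>p \<ge> 3\<close> to \<open>(n - 1) / 2\<close>.\<close>

lemma padic_norm_fact_exponent:
  assumes "odd CARD('p::prime_card)" "n \<ge> 1"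
  obtains v where "2 * v + 1 \<le> n" "padic_norm (fact n :: 'p padic) = (1 / real CARD('p)) ^ v"
proof -
  let ?p = "CARD('p)"
  have p: "?p \<ge> 3" using CARD_gt_1[where 'p = 'p] assms(1) by presburger
  have "\<exists>v. 2 * v + 1 \<le> n \<and> padic_norm (fact n :: 'p padic) = (1 / real ?p) ^ v"
    using assms(2)
  proof (induction n rule: less_induct)
    case (less n)
    define m where "m = n div ?p"
    have n: "n = ?p * m + n mod ?p" by (simp add: m_def)
    have "n mod ?p < ?p" using p by simp
    hence N: "padic_norm (fact n :: 'p padic) = (1 / real ?p) ^ m * padic_norm (fact m :: 'p padic)"
      using padic_norm_fact_add[of "n mod ?p" m, where 'p = 'p] n padic_norm_fact_mult[of m, where 'p = 'p]
      by metis
    show ?case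
    proof (cases "m = 0")
      case True
      thus ?thesis using N less.prems by (intro exI[of _ 0]) simp
    next
      case False
      have "3 * m \<le> ?p * m" using p by (rule mult_le_mono1)
      hence mn: "3 * m \<le> n" using n by linarith
      hence "m < n" "1 \<le> m" using False by auto
      then obtain v where v: "2 * v + 1 \<le> m" "padic_norm (fact m :: 'p padic) = (1 / real ?p) ^ v"
        using less.IH by blast
      \<comment> \<open>From \<open>2 * v + 1 <= m\<close> and \<open>3 * m <= n\<close> follows
        \<open>2 * (m + v) + 1 <= n\<close>; this is where \<open>p >= 3\<close> is spent.\<close>
      thus ?thesis using N mn by (intro exI[of _ "m + v"]) (simp add: power_add)
    qed
  qed
  thus ?thesis using that by blast
qed

text \<open>The value group is discrete: a rational closer to \<open>x\<close> than
  \<open>padic_norm x\<close> has the same norm as \<open>x\<close>, so this norm is an integer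
  power of \<open>p\<close>, and below 1 the exponent is at most \<open>-1\<close>.\<close>

lemma padic_norm_less_1_imp:
  fixes x :: "'p::prime_card padic"
  assumes "padic_norm x < 1"
  shows "padic_norm x \<le> 1 / real CARD('p)"
proof (cases "x = 0")
  case False
  let ?p = "real CARD('p)"
  have p: "?p > 1" using CARD_gt_1[where 'p = 'p] by simp
  have pos: "padic_norm x > 0" using False padic_norm_nonneg[of x] by (simp add: order_less_le)
  obtain r where "dist x (of_rat r) < padic_norm x" using of_rat_dense_padic[OF pos] by blast
  hence r: "padic_norm (x - of_rat r) < padic_norm x" by (simp add: dist_padic_def)
  have "padic_norm (of_rat r :: 'p padic) \<le> padic_norm x"
    using padic_norm_diff_le[of x "padic_norm x" "x - of_rat r"] r by simp
  moreover have "padic_norm x \<le> padic_norm (of_rat r :: 'p padic)"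
    using padic_norm_ultrametric[of "x - of_rat r" "of_rat r"] r by simp
  ultimately have eq: "padic_norm x = padic_abs CARD('p) r" by (simp add: padic_norm_of_rat)
  hence "r \<noteq> 0" using pos by auto
  hence "\<exists>k. padic_abs CARD('p) r = ?p powi k"
    by (auto simp: padic_abs_def split: prod.splits)
  then obtain k where k: "padic_norm x = ?p powi k" using eq by auto
  have "k \<le> -1"
  proof (rule ccontr)
    assume "\<not> k \<le> -1"
    hence "?p powi k \<ge> ?p powi 0" using p by (intro power_int_increasing) auto
    thus False using assms k by simp
  qed
  hence "?p powi k \<le> ?p powi (-1)" using p by (intro power_int_increasing) auto
  thus ?thesis by (simp add: k inverse_eq_divide)
qed simp


section \<open>Exponential-type series on the open unit disc\<close>

text \<open>The weights \<open>w\<close> allow sine, cosine and their products to be treated by one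
  set of estimates.\<close>

definition exp_term :: "(nat \<Rightarrow> 'p::prime_card padic) \<Rightarrow> 'p padic \<Rightarrow> nat \<Rightarrow> 'p padic" where
  "exp_term w x n = w n * x ^ n / fact n"

context
  fixes w :: "nat \<Rightarrow> 'p::prime_card padic" and x :: "'p padic"
  assumes odd: "odd CARD('p)" and w: "\<And>n. padic_norm (w n) \<le> 1" and x: "padic_norm x < 1"
begin

lemma padic_norm_exp_term_le: "padic_norm (exp_term w x n) \<le> padic_norm x ^ n / padic_norm (fact n :: 'p padic)"
  using mult_right_mono[OF w[of n], of "padic_norm x ^ n / padic_norm (fact n :: 'p padic)"]
  by (simp add: exp_term_def padic_norm_mult padic_norm_divide padic_norm_power)

text \<open>With \<open>q = 1/p\<close>, the power contributes at most \<open>q ^ n\<close> and the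
  factorial takes back \<open>q ^ v\<close>. Since \<open>2 * v < n\<close>, at least half of the
  exponent survives, whence the ratio \<open>sqrt q\<close>.\<close>

lemma padic_norm_exp_term_geometric:
  "padic_norm (exp_term w x n) \<le> sqrt (1 / real CARD('p)) ^ n"
proof (cases "n = 0")
  case True
  thus ?thesis using w[of 0] by (simp add: exp_term_def)
next
  case False
  let ?q = "1 / real CARD('p)"
  have p: "real CARD('p) > 1" using CARD_gt_1[where 'p = 'p] by simp
  obtain v where v: "2 * v + 1 \<le> n" "padic_norm (fact n :: 'p padic) = ?q ^ v"
    using padic_norm_fact_exponent[OF odd, of n] False by auto
  have "padic_norm (exp_term w x n) \<le> padic_norm x ^ n / ?q ^ v"
    using padic_norm_exp_term_le[of n] v by simp
  also have "\<dots> \<le> ?q ^ n / ?q ^ v"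
    using padic_norm_less_1_imp[OF x] p by (intro divide_right_mono power_mono) auto
  also have "\<dots> = ?q ^ (n - v)"
    using v p by (subst power_diff) auto
  also have "\<dots> = (sqrt ?q ^ 2) ^ (n - v)"
    using p by simp
  also have "\<dots> = sqrt ?q ^ (2 * (n - v))" by (rule power_mult[symmetric])
  also have "\<dots> \<le> sqrt ?q ^ n"
    using v p by (intro power_decreasing) auto
  finally show ?thesis .
qed

text \<open>Two factors \<open>padic_norm x\<close> are set aside; the other \<open>n - 2\<close>,
  each at most \<open>1/p\<close>, absorb the factorial.\<close>

lemma padic_norm_exp_term_square:
  assumes n: "n \<ge> 2"
  shows "padic_norm (exp_term w x n) \<le> padic_norm x ^ 2"
proof -
  let ?q = "1 / real CARD('p)"
  have p: "real CARD('p) > 1" using CARD_gt_1[where 'p = 'p] by simp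
  obtain v where v: "2 * v + 1 \<le> n" "padic_norm (fact n :: 'p padic) = ?q ^ v"
    using padic_norm_fact_exponent[OF odd, of n] n by auto
  \<comment> \<open>The \<open>+ 1\<close> in the factorial bound matters at \<open>n = 2\<close>,
    where it forces \<open>v = 0\<close>.\<close>
  have vn: "v \<le> n - 2" using v n by linarith
  have "padic_norm (exp_term w x n) \<le> padic_norm x ^ n / ?q ^ v"
    using padic_norm_exp_term_le[of n] v by simp
  also have "padic_norm x ^ n = padic_norm x ^ 2 * padic_norm x ^ (n - 2)"
    using n by (simp only: le_add_diff_inverse flip: power_add)
  also have "\<dots> / ?q ^ v = padic_norm x ^ 2 * (padic_norm x ^ (n - 2) / ?q ^ v)" by simp
  also have "\<dots> \<le> padic_norm x ^ 2 * 1"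
  proof (rule mult_left_mono)
    have "padic_norm x ^ (n - 2) \<le> ?q ^ (n - 2)"
      using padic_norm_less_1_imp[OF x] by (intro power_mono) auto
    also have "\<dots> \<le> ?q ^ v" using vn p by (intro power_decreasing) auto
    finally show "padic_norm x ^ (n - 2) / ?q ^ v \<le> 1" using p by (simp add: field_simps)
  qed simp
  finally show ?thesis by simp
qed

lemma exp_term_summable: "summable (exp_term w x)"
  using CARD_gt_1[where 'p = 'p]
  by (intro padic_summable_geometric[OF padic_norm_exp_term_geometric]) auto

text \<open>Removing the terms of index 0 and 1 leaves a series all of whose terms have norm at most
  \<open>padic_norm x ^ 2\<close>.\<close>

lemma padic_norm_exp_series_linear:
  "padic_norm ((\<Sum>n. exp_term w x n) - w 0 - w 1 * x) \<le> padic_norm x ^ 2"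
proof -
  have S: "exp_term w x sums (\<Sum>n. exp_term w x n)"
    by (rule summable_sums[OF exp_term_summable])
  have F: "(\<lambda>n. if n \<in> {0, 1} then exp_term w x n else 0) sums sum (exp_term w x) {0, 1}"
    by (rule sums_If_finite_set) simp
  have "(\<lambda>n. exp_term w x n + - (if n \<in> {0, 1} then exp_term w x n else 0))
      sums ((\<Sum>n. exp_term w x n) + - sum (exp_term w x) {0, 1})"
    using S F unfolding sums_def sum.distrib sum_negf by (intro tendsto_add tendsto_minus)
  hence "padic_norm ((\<Sum>n. exp_term w x n) + - sum (exp_term w x) {0, 1}) \<le> padic_norm x ^ 2"
    by (rule padic_sums_norm_le) (auto simp: padic_norm_exp_term_square)
  thus ?thesis by (simp add: exp_term_def algebra_simps)
qed

end

section \<open>Addition formulas for weighted exponential series\<close>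

lemma exp_term_product_sums:
  fixes x y :: "'p::prime_card padic"
  assumes "odd CARD('p)" "\<And>n. padic_norm (v n :: 'p padic) \<le> 1" "\<And>n. padic_norm (w n :: 'p padic) \<le> 1"
    "padic_norm x < 1" "padic_norm y < 1"
  shows "(\<lambda>n. \<Sum>i\<le>n. exp_term v x i * exp_term w y (n - i)) sums
    ((\<Sum>n. exp_term v x n) * (\<Sum>n. exp_term w y n))"
  using assms CARD_gt_1[where 'p = 'p]
  by (intro padic_Cauchy_product_sums[where r = "sqrt (1 / real CARD('p))"]
      padic_norm_exp_term_geometric summable_sums exp_term_summable) auto

text \<open>The binomial theorem, with \<open>n choose i\<close> cancelling against
  \<open>fact n\<close>. The weight of \<open>i + j\<close> is a sum of two products, as in the
  addition formulas of sine and cosine.\<close>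

lemma exp_term_binomial:
  fixes x y :: "'p::prime_card padic"
  assumes "\<And>i j. w (i + j) = v i * u j + v' i * u' j"
  shows "exp_term w (x + y) n = (\<Sum>i\<le>n. exp_term v x i * exp_term u y (n - i)) +
    (\<Sum>i\<le>n. exp_term v' x i * exp_term u' y (n - i))"
proof -
  have "exp_term w (x + y) n = (\<Sum>i\<le>n. w n * (of_nat (n choose i) * x ^ i * y ^ (n - i)) / fact n)"
    by (simp add: exp_term_def binomial_ring sum_distrib_left sum_divide_distrib)
  also have "\<dots> = (\<Sum>i\<le>n. exp_term v x i * exp_term u y (n - i) + exp_term v' x i * exp_term u' y (n - i))"
  proof (rule sum.cong)
    fix i assume "i \<in> {..n}"
    hence i: "i \<le> n" by simp
    have "w n * (of_nat (n choose i) * x ^ i * y ^ (n - i)) / fact n =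
      w n * (x ^ i / fact i) * (y ^ (n - i) / fact (n - i))"
      using i by (simp add: binomial_fact)
    moreover have "w n = v i * u (n - i) + v' i * u' (n - i)" using assms[of i "n - i"] i by simp
    ultimately show "w n * (of_nat (n choose i) * x ^ i * y ^ (n - i)) / fact n =
      exp_term v x i * exp_term u y (n - i) + exp_term v' x i * exp_term u' y (n - i)"
      by (simp add: exp_term_def algebra_simps)
  qed simp
  finally show ?thesis by (simp add: sum.distrib)
qed

lemma exp_series_add:
  fixes x y :: "'p::prime_card padic"
  assumes odd: "odd CARD('p)" and x: "padic_norm x < 1" and y: "padic_norm y < 1"
    and w: "\<And>i j. w (i + j) = v i * u j + v' i * u' j"
    and le: "\<And>n. padic_norm (v n) \<le> 1" "\<And>n. padic_norm (u n) \<le> 1"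
      "\<And>n. padic_norm (v' n) \<le> 1" "\<And>n. padic_norm (u' n) \<le> 1"
  shows "(\<Sum>n. exp_term w (x + y) n) = (\<Sum>n. exp_term v x n) * (\<Sum>n. exp_term u y n) +
    (\<Sum>n. exp_term v' x n) * (\<Sum>n. exp_term u' y n)"
proof -
  have "exp_term w (x + y) = (\<lambda>n. (\<Sum>i\<le>n. exp_term v x i * exp_term u y (n - i)) +
      (\<Sum>i\<le>n. exp_term v' x i * exp_term u' y (n - i)))"
    by (intro ext exp_term_binomial w)
  hence "exp_term w (x + y) sums ((\<Sum>n. exp_term v x n) * (\<Sum>n. exp_term u y n) +
      (\<Sum>n. exp_term v' x n) * (\<Sum>n. exp_term u' y n))"
    using exp_term_product_sums[OF odd le(1,2) x y] exp_term_product_sums[OF odd le(3,4) x y]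
    by (simp only: sums_add)
  thus ?thesis by (rule sums_unique[symmetric])
qed


section \<open>Sine and cosine on the open unit disc\<close>

text \<open>
  \<open>\<rat>\<^sub>p\<close> need not contain a square root \<open>i\<close> of \<open>-1\<close>, so the real and imaginary parts of \<open>i\<^sup>n\<close> are kept
  apart as weights of the exponential series.
\<close>

definition cos_sign :: "nat \<Rightarrow> 'p::prime_card padic" where
  "cos_sign n = (if even n then (-1) ^ (n div 2) else 0)"

definition sin_sign :: "nat \<Rightarrow> 'p::prime_card padic" where
  "sin_sign n = (if even n then 0 else (-1) ^ (n div 2))"

lemma sign_simps [simp]: "cos_sign 0 = 1" "cos_sign (Suc 0) = 0" "sin_sign 0 = 0" "sin_sign (Suc 0) = 1"
  by (simp_all add: cos_sign_def sin_sign_def)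

lemma padic_norm_sign:
  "padic_norm (cos_sign n :: 'p::prime_card padic) \<le> 1"
  "padic_norm (sin_sign n :: 'p::prime_card padic) \<le> 1"
  "padic_norm (- sin_sign n :: 'p::prime_card padic) \<le> 1"
  by (simp_all add: cos_sign_def sin_sign_def padic_norm_power)

text \<open>Real and imaginary parts of the power law for a square root of \<open>-1\<close>. The
  minus sign sits on the first weight so that the shape fits \<open>exp_series_add\<close>.\<close>

lemma sign_add:
  "cos_sign (i + j) = cos_sign i * cos_sign j + (- sin_sign i) * (sin_sign j :: 'p::prime_card padic)"
  "sin_sign (i + j) = sin_sign i * cos_sign j + cos_sign i * (sin_sign j :: 'p::prime_card padic)"
  by (cases "even i"; cases "even j";
      auto simp: cos_sign_def sin_sign_def power_add elim!: evenE oddE)+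

text \<open>The inserted odd terms vanish, so both series have the same sums. The identity holds for
  every \<open>x\<close>, even where they diverge, because \<open>suminf\<close> depends only on the
  predicate \<open>sums\<close>.\<close>

lemma padic_cos_eq: "padic_cos x = (\<Sum>n. exp_term cos_sign x n)"
proof -
  have "(\<lambda>n. exp_term cos_sign x (2 * n)) sums c \<longleftrightarrow> exp_term cos_sign x sums c" for c
    by (rule sums_mono_reindex)
       (auto simp: strict_mono_def exp_term_def cos_sign_def elim!: evenE)
  moreover have "(\<lambda>n. exp_term cos_sign x (2 * n)) = padic_cos_term x"
    by (simp add: fun_eq_iff exp_term_def padic_cos_term_def cos_sign_def)
  ultimately show ?thesis by (simp add: padic_cos_def suminf_def)
qed

lemma padic_sin_eq: "padic_sin x = (\<Sum>n. exp_term sin_sign x n)"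
proof -
  have "(\<lambda>n. exp_term sin_sign x (2 * n + 1)) sums c \<longleftrightarrow> exp_term sin_sign x sums c" for c
    by (rule sums_mono_reindex)
       (auto simp: strict_mono_def exp_term_def sin_sign_def elim!: oddE)
  moreover have "(\<lambda>n. exp_term sin_sign x (2 * n + 1)) = padic_sin_term x"
    by (simp add: fun_eq_iff exp_term_def padic_sin_term_def sin_sign_def)
  ultimately show ?thesis by (simp add: padic_sin_def suminf_def)
qed

lemma exp_term_uminus: "exp_term (\<lambda>n. - w n) x n = - exp_term w x n"
  by (simp add: exp_term_def)

lemma padic_cos_0: "padic_cos (0 :: 'p::prime_card padic) = 1"
proof -
  have "(\<lambda>n. if n \<in> {0} then padic_cos_term (0 :: 'p padic) n else 0) sums sum (padic_cos_term 0) {0}"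
    by (rule sums_If_finite_set) simp
  moreover have "(\<lambda>n. if n \<in> {0} then padic_cos_term (0 :: 'p padic) n else 0) = padic_cos_term 0"
    by (auto simp: fun_eq_iff padic_cos_term_def)
  ultimately have "padic_cos_term (0 :: 'p padic) sums 1"
    by (simp add: padic_cos_term_def)
  thus ?thesis unfolding padic_cos_def by (rule sums_unique[symmetric])
qed

lemma padic_sin_0: "padic_sin (0 :: 'p::prime_card padic) = 0"
  by (simp add: padic_sin_def padic_sin_term_def)

lemma padic_suminf_minus:
  fixes f :: "nat \<Rightarrow> 'p::prime_card padic"
  assumes "summable f"
  shows "(\<Sum>n. - f n) = - (\<Sum>n. f n)"
proof -
  have "(\<lambda>n. - f n) sums - (\<Sum>n. f n)"
    using summable_sums[OF assms] unfolding sums_def sum_negf by (rule tendsto_minus)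
  thus ?thesis by (rule sums_unique[symmetric])
qed

section \<open>Addition formulas, size estimates and non-vanishing\<close>

context
  fixes x :: "'p::prime_card padic"
  assumes odd: "odd CARD('p)" and x: "padic_norm x < 1"
begin

lemma padic_cos_add:
  assumes "padic_norm y < 1"
  shows "padic_cos (x + y) = padic_cos x * padic_cos y - padic_sin x * padic_sin y"
proof -
  have "(\<Sum>n. exp_term (\<lambda>n. - sin_sign n) x n) = - padic_sin x"
    using padic_suminf_minus[OF exp_term_summable[where w = sin_sign, OF odd padic_norm_sign(2) x]]
    by (simp add: exp_term_uminus padic_sin_eq)
  thus ?thesis
    using exp_series_add[where v' = "\<lambda>n. - sin_sign n" and u' = sin_sign, OF odd x assms sign_add(1)]
    by (simp add: padic_cos_eq padic_sin_eq padic_norm_sign)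
qed

lemma padic_sin_add:
  assumes "padic_norm y < 1"
  shows "padic_sin (x + y) = padic_sin x * padic_cos y + padic_cos x * padic_sin y"
  using exp_series_add[where v' = cos_sign and u' = sin_sign, OF odd x assms sign_add(2)]
  by (simp add: padic_cos_eq padic_sin_eq padic_norm_sign)

lemma padic_cos_linear: "padic_norm (padic_cos x - 1) \<le> padic_norm x ^ 2"
  using padic_norm_exp_series_linear[where w = cos_sign, OF odd padic_norm_sign(1) x] by (simp add: padic_cos_eq)

lemma padic_sin_linear: "padic_norm (padic_sin x - x) \<le> padic_norm x ^ 2"
  using padic_norm_exp_series_linear[where w = sin_sign, OF odd padic_norm_sign(2) x] by (simp add: padic_sin_eq)

lemma padic_norm_square_le: "padic_norm x ^ 2 \<le> padic_norm x"
  using x mult_left_mono[of "padic_norm x" 1 "padic_norm x"] by (simp add: power2_eq_square)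

lemma padic_norm_cos_diff_1: "padic_norm (padic_cos x - 1) \<le> padic_norm x"
  using padic_cos_linear padic_norm_square_le by linarith

lemma padic_norm_sin_le: "padic_norm (padic_sin x) \<le> padic_norm x"
  using padic_norm_add_le[of "padic_sin x - x" "padic_norm x" x] padic_sin_linear padic_norm_square_le
  by simp

lemma padic_norm_cos_le_1: "padic_norm (padic_cos x) \<le> 1"
  using padic_norm_add_le[of "padic_cos x - 1" 1 1] padic_norm_cos_diff_1 x by simp

lemma padic_norm_sin_le_1: "padic_norm (padic_sin x) \<le> 1"
  using padic_norm_sin_le x by simp

text \<open>A zero would give \<open>padic_cos x - 1\<close> the norm 1, but that norm is below
  1.\<close>

lemma padic_cos_nonzero: "padic_cos x \<noteq> 0"
  using padic_norm_cos_diff_1 x by auto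

lemma padic_cos_add_1_nonzero: "padic_cos x + 1 \<noteq> 0"
proof
  assume "padic_cos x + 1 = 0"
  hence "padic_cos x - 1 = - 2" by (simp add: eq_neg_iff_add_eq_0 add.commute)
  hence "padic_norm (padic_cos x - 1) = 1"
    by (simp only: padic_norm_minus padic_norm_2[OF odd])
  thus False using padic_norm_cos_diff_1 x by simp
qed

text \<open>The addition formula for \<open>x + (- x)\<close>, with cosine even and sine
  odd.\<close>

lemma padic_cos_sin_squared: "padic_cos x ^ 2 + padic_sin x ^ 2 = 1"
proof -
  have "padic_cos_term (- x) = padic_cos_term x"
    by (simp add: fun_eq_iff padic_cos_term_def)
  hence c: "padic_cos (- x) = padic_cos x" by (simp add: padic_cos_def)
  have "exp_term sin_sign (- x) = (\<lambda>n. - exp_term sin_sign x n)"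
    by (auto simp: fun_eq_iff exp_term_def sin_sign_def)
  moreover have "summable (exp_term sin_sign x)"
    by (intro exp_term_summable odd padic_norm_sign x)
  ultimately have s: "padic_sin (- x) = - padic_sin x"
    by (simp add: padic_sin_eq padic_suminf_minus)
  show ?thesis using padic_cos_add[of "- x"] x c s
    by (simp add: power2_eq_square padic_cos_0)
qed

end

section \<open>Second-order Taylor bounds and Lipschitz bounds\<close>

context
  fixes u v :: "'p::prime_card padic"
  assumes odd: "odd CARD('p)" and u: "padic_norm u < 1" and v: "padic_norm v < 1"
begin

lemma padic_norm_lincomb_le:
  fixes b c h k :: "'p padic"
  assumes "padic_norm b \<le> 1" "padic_norm c \<le> 1" "padic_norm h \<le> B" "padic_norm k \<le> B"
  shows "padic_norm (b * h + c * k) \<le> B"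
  using assms mult_mono[of "padic_norm b" 1 "padic_norm h" B] mult_mono[of "padic_norm c" 1 "padic_norm k" B]
  by (intro padic_norm_add_le) (auto simp: padic_norm_mult)

lemma padic_norm_diff_less_1: "padic_norm (u - v) < 1"
  using padic_norm_diff_le[of u "max (padic_norm u) (padic_norm v)" v] u v by auto

text \<open>Expanding at \<open>v + h\<close> by the addition formula leaves only
  \<open>cos h - 1\<close> and \<open>sin h - h\<close>, both of second order, with coefficients of
  norm at most 1.\<close>

lemma padic_cos_taylor:
  "padic_norm (padic_cos u - padic_cos v - (- padic_sin v) * (u - v)) \<le> padic_norm (u - v) ^ 2"
proof -
  define h where "h = u - v"
  have h: "padic_norm h < 1" unfolding h_def by (rule padic_norm_diff_less_1)
  have "padic_cos u = padic_cos v * padic_cos h - padic_sin v * padic_sin h"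
    using padic_cos_add[OF odd v h] by (simp add: h_def)
  hence "padic_cos u - padic_cos v - (- padic_sin v) * h =
      padic_cos v * (padic_cos h - 1) + (- padic_sin v) * (padic_sin h - h)"
    by (simp add: algebra_simps)
  also have "padic_norm \<dots> \<le> padic_norm h ^ 2"
    using odd v h
    by (intro padic_norm_lincomb_le padic_cos_linear padic_sin_linear padic_norm_cos_le_1)
       (simp_all add: padic_norm_sin_le_1)
  finally show ?thesis by (simp add: h_def)
qed

lemma padic_sin_taylor:
  "padic_norm (padic_sin u - padic_sin v - padic_cos v * (u - v)) \<le> padic_norm (u - v) ^ 2"
proof -
  define h where "h = u - v"
  have h: "padic_norm h < 1" unfolding h_def by (rule padic_norm_diff_less_1)
  have "padic_sin u = padic_sin v * padic_cos h + padic_cos v * padic_sin h"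
    using padic_sin_add[OF odd v h] by (simp add: h_def)
  hence "padic_sin u - padic_sin v - padic_cos v * h =
      padic_sin v * (padic_cos h - 1) + padic_cos v * (padic_sin h - h)"
    by (simp add: algebra_simps)
  also have "padic_norm \<dots> \<le> padic_norm h ^ 2"
    using odd v h
    by (intro padic_norm_lincomb_le padic_cos_linear padic_sin_linear padic_norm_cos_le_1 padic_norm_sin_le_1)
  finally show ?thesis by (simp add: h_def)
qed

lemma padic_cos_lipschitz: "padic_norm (padic_cos u - padic_cos v) \<le> padic_norm (u - v)"
proof -
  \<comment> \<open>Second-order remainder plus linear term; the factor 1 gives the shape of
    \<open>padic_norm_lincomb_le\<close>.\<close>
  have "padic_norm (1 * (padic_cos u - padic_cos v - (- padic_sin v) * (u - v)) +
      (- padic_sin v) * (u - v)) \<le> padic_norm (u - v)"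
    using padic_cos_taylor padic_norm_square_le[OF odd padic_norm_diff_less_1] padic_norm_sin_le_1[OF odd v]
    by (intro padic_norm_lincomb_le) auto
  thus ?thesis by simp
qed

lemma padic_sin_lipschitz: "padic_norm (padic_sin u - padic_sin v) \<le> padic_norm (u - v)"
proof -
  have "padic_norm (1 * (padic_sin u - padic_sin v - padic_cos v * (u - v)) +
      padic_cos v * (u - v)) \<le> padic_norm (u - v)"
    using padic_sin_taylor padic_norm_square_le[OF odd padic_norm_diff_less_1] padic_norm_cos_le_1[OF odd v]
    by (intro padic_norm_lincomb_le) auto
  thus ?thesis by simp
qed

end


section \<open>The fermionic integrals\<close>

text \<open>Here \<open>g\<close> is the derivative. The quotient at \<open>(x, y)\<close> is within
  \<open>padic_norm (x - y)\<close> of \<open>g y\<close>, which is within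
  \<open>padic_norm (y - z)\<close> of \<open>g z\<close>.\<close>

lemma strictly_differentiable_on_taylor:
  fixes f g :: "'p::prime_card padic \<Rightarrow> 'p padic"
  assumes f: "\<And>x y. x \<in> S \<Longrightarrow> y \<in> S \<Longrightarrow> padic_norm (f x - f y - g y * (x - y)) \<le> padic_norm (x - y) ^ 2"
    and g: "\<And>x y. x \<in> S \<Longrightarrow> y \<in> S \<Longrightarrow> padic_norm (g x - g y) \<le> padic_norm (x - y)"
  shows "strictly_differentiable_on S f"
  unfolding strictly_differentiable_on_def
proof (intro ballI exI)
  fix z assume z: "z \<in> S"
  let ?F = "at (z, z) within {(x, y). x \<in> S \<and> y \<in> S \<and> x \<noteq> y}"
  show "((\<lambda>(x, y). (f x - f y) / (x - y)) \<longlongrightarrow> g z) ?F"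
  proof (rule tendsto_padic_sandwich)
    have 1: "(fst \<longlongrightarrow> z) ?F" and 2: "(snd \<longlongrightarrow> z) ?F"
      using tendsto_fst[OF tendsto_ident_at] tendsto_snd[OF tendsto_ident_at] by fastforce+
    have "((\<lambda>q. fst q - snd q) \<longlongrightarrow> 0) ?F" using tendsto_diff[OF 1 2] by simp
    from tendsto_add_zero[OF tendsto_padic_norm_diff[OF this] tendsto_padic_norm_diff[OF 2]]
    show "((\<lambda>q. padic_norm (fst q - snd q) + padic_norm (snd q - z)) \<longlongrightarrow> 0) ?F" by simp
    have "padic_norm ((f x - f y) / (x - y) - g z) \<le> padic_norm (x - y) + padic_norm (y - z)"
      if xy: "x \<in> S" "y \<in> S" "x \<noteq> y" for x y
    proof -
      have pos: "padic_norm (x - y) > 0"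
        using xy(3) padic_norm_nonneg[of "x - y"] by (simp add: order_less_le)
      have "(f x - f y) / (x - y) - g z = (f x - f y - g y * (x - y)) / (x - y) + (g y - g z)"
        using xy(3) by (simp add: diff_divide_distrib)
      also have "padic_norm \<dots> \<le> padic_norm ((f x - f y - g y * (x - y)) / (x - y)) + padic_norm (g y - g z)"
        by (rule padic_norm_triangle)
      also have "\<dots> \<le> padic_norm (x - y) + padic_norm (y - z)"
        using f[OF xy(1,2)] g[OF xy(2) z] pos
        by (intro add_mono) (simp_all add: padic_norm_divide divide_le_eq power2_eq_square)
      finally show ?thesis .
    qed
    thus "\<forall>\<^sub>F q in ?F. padic_norm ((case q of (x, y) \<Rightarrow> (f x - f y) / (x - y)) - g z) \<le>
        padic_norm (fst q - snd q) + padic_norm (snd q - z)"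
      by (auto simp: eventually_at_filter intro!: always_eventually)
  qed
qed

text \<open>The terms of a convergent series tend to 0, but for \<open>padic_norm x >= 1\<close>
  every cosine term has norm at least 1, since factorials have norm at most 1.\<close>

lemma padic_trig_domain_norm_less_1:
  assumes "(x :: 'p::prime_card padic) \<in> padic_trig_domain"
  shows "padic_norm x < 1"
proof (rule ccontr)
  assume "\<not> padic_norm x < 1"
  hence x: "padic_norm x \<ge> 1" by simp
  let ?S = "\<lambda>n. \<Sum>k<n. padic_cos_term x k"
  obtain L where L: "?S \<longlonglongrightarrow> L"
    using assms by (auto simp: padic_trig_domain_def summable_def sums_def)
  have "(\<lambda>n. ?S (Suc n) - ?S n) \<longlonglongrightarrow> L - L"
    by (intro tendsto_diff L LIMSEQ_Suc)
  hence "padic_cos_term x \<longlonglongrightarrow> 0" by simp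
  from tendsto_padic_norm_diff[OF this] have "(\<lambda>n. padic_norm (padic_cos_term x n)) \<longlonglongrightarrow> 0"
    by simp
  hence "\<forall>\<^sub>F n in sequentially. padic_norm (padic_cos_term x n) < 1"
    by (rule order_tendstoD) simp
  then obtain n where n: "padic_norm (padic_cos_term x n) < 1"
    by (auto simp: eventually_sequentially)
  have "padic_norm (fact (2 * n) :: 'p padic) > 0"
    using padic_norm_nonneg[of "fact (2 * n) :: 'p padic"] by (simp add: order_less_le)
  moreover have "padic_norm (fact (2 * n) :: 'p padic) \<le> padic_norm x ^ (2 * n)"
    using padic_norm_fact_le_1[of "2 * n", where 'p = 'p] one_le_power[OF x, of "2 * n"] by linarith
  ultimately have "padic_norm (padic_cos_term x n) \<ge> 1"
    by (simp add: padic_cos_term_def padic_norm_mult padic_norm_divide padic_norm_power)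
  thus False using n by simp
qed

lemma padic_norm_mult_integer_le:
  "y \<in> padic_integers \<Longrightarrow> padic_norm (x * y) \<le> padic_norm (x :: 'p::prime_card padic)"
  using mult_left_mono[of "padic_norm y" 1 "padic_norm x"] by (simp add: padic_norm_mult padic_integers_def)

text \<open>Telescoping. For odd \<open>n\<close> the value is \<open>f 0 + f n\<close>, the finite
  form of the fermionic shift equation.\<close>

lemma alternating_sum_shift:
  fixes f :: "nat \<Rightarrow> 'a::comm_ring_1"
  shows "(\<Sum>k<n. (f (Suc k) + f k) * (-1) ^ k) = f 0 - (-1) ^ n * f n"
  by (induction n) (simp_all add: algebra_simps)

section \<open>Sine and cosine of \<open>a * x\<close> for \<open>x\<close> in the
  \<open>p\<close>-adic integers\<close>

context
  fixes a :: "'p::prime_card padic"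
  assumes odd: "odd CARD('p)" and a: "padic_norm a < 1"
begin

lemma padic_norm_scaled_less_1: "x \<in> padic_integers \<Longrightarrow> padic_norm (a * x) < 1"
  using padic_norm_mult_integer_le[of x a] a by linarith

text \<open>Chain rule with derivative \<open>a * g (a * x)\<close>; scaling by \<open>a\<close> of
  norm below 1 preserves both bounds.\<close>

lemma strictly_differentiable_scaled_comp:
  fixes f g :: "'p padic \<Rightarrow> 'p padic"
  assumes f: "\<And>u v. padic_norm u < 1 \<Longrightarrow> padic_norm v < 1 \<Longrightarrow>
      padic_norm (f u - f v - g v * (u - v)) \<le> padic_norm (u - v) ^ 2"
    and g: "\<And>u v. padic_norm u < 1 \<Longrightarrow> padic_norm v < 1 \<Longrightarrow>
      padic_norm (g u - g v) \<le> padic_norm (u - v)"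
  shows "strictly_differentiable_on padic_integers (\<lambda>x. f (a * x))"
proof (rule strictly_differentiable_on_taylor)
  fix x y :: "'p padic" assume xy: "x \<in> padic_integers" "y \<in> padic_integers"
  have le: "padic_norm (a * x - a * y) \<le> padic_norm (x - y)"
    using a mult_right_mono[of "padic_norm a" 1 "padic_norm (x - y)"]
    by (simp flip: right_diff_distrib add: padic_norm_mult)
  have "padic_norm (f (a * x) - f (a * y) - g (a * y) * (a * x - a * y)) \<le> padic_norm (a * x - a * y) ^ 2"
    by (intro f padic_norm_scaled_less_1 xy)
  also have "\<dots> \<le> padic_norm (x - y) ^ 2" using le by (intro power_mono) auto
  finally show "padic_norm (f (a * x) - f (a * y) - (a * g (a * y)) * (x - y)) \<le> padic_norm (x - y) ^ 2"
    by (simp add: algebra_simps)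
  have "padic_norm (g (a * x) - g (a * y)) \<le> padic_norm (a * x - a * y)"
    by (intro g padic_norm_scaled_less_1 xy)
  hence "padic_norm (g (a * x) - g (a * y)) \<le> padic_norm (x - y)" using le by linarith
  hence "padic_norm a * padic_norm (g (a * x) - g (a * y)) \<le> 1 * padic_norm (x - y)"
    using a by (intro mult_mono) auto
  thus "padic_norm (a * g (a * x) - a * g (a * y)) \<le> padic_norm (x - y)"
    by (simp flip: right_diff_distrib add: padic_norm_mult)
qed

lemma strictly_differentiable_cos: "strictly_differentiable_on padic_integers (\<lambda>x. padic_cos (a * x))"
proof (rule strictly_differentiable_scaled_comp)
  fix u v :: "'p padic" assume uv: "padic_norm u < 1" "padic_norm v < 1"
  show "padic_norm (padic_cos u - padic_cos v - (- padic_sin v) * (u - v)) \<le> padic_norm (u - v) ^ 2"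
    by (rule padic_cos_taylor[OF odd uv])
  show "padic_norm (- padic_sin u - - padic_sin v) \<le> padic_norm (u - v)"
    using padic_sin_lipschitz[OF odd uv] padic_norm_minus[of "padic_sin u - padic_sin v"] by simp
qed

lemma strictly_differentiable_sin: "strictly_differentiable_on padic_integers (\<lambda>x. padic_sin (a * x))"
  by (rule strictly_differentiable_scaled_comp[where g = padic_cos])
     (rule padic_sin_taylor[OF odd] padic_cos_lipschitz[OF odd]; assumption)+

lemma fermionic_trig_limits:
  "(\<lambda>N. \<Sum>x<CARD('p) ^ N. padic_cos (a * of_nat x) * (-1) ^ x) \<longlonglongrightarrow> 1"
  "(\<lambda>N. \<Sum>x<CARD('p) ^ N. padic_sin (a * of_nat x) * (-1) ^ x) \<longlonglongrightarrow>
    - (padic_sin a / (padic_cos a + 1))"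
proof -
  define c s where "c = padic_cos a" and "s = padic_sin a"
  define C S where "C = (\<lambda>n. padic_cos (a * of_nat n))" and "S = (\<lambda>n. padic_sin (a * of_nat n))"
  define M where "M = (\<lambda>N. CARD('p) ^ N)"
  define T U where "T = (\<lambda>N. \<Sum>x<M N. C x * (-1) ^ x)" and "U = (\<lambda>N. \<Sum>x<M N. S x * (-1) ^ x)"
  have small: "padic_norm (a * of_nat n) < 1" for n
    by (rule padic_norm_scaled_less_1) (simp add: padic_integers_def padic_norm_of_nat_le_1)
  have C_Suc: "C (Suc n) = C n * c - S n * s" and S_Suc: "S (Suc n) = S n * c + C n * s" for n
    using padic_cos_add[OF odd small a, of n] padic_sin_add[OF odd small a, of n]
    by (simp_all add: C_def S_def c_def s_def algebra_simps)
  have C0: "C 0 = 1" "S 0 = 0" by (simp_all add: C_def S_def padic_cos_0 padic_sin_0)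
  \<comment> \<open>Parity of \<open>p ^ N\<close>: it makes the boundary terms add in
    \<open>eq1\<close> and \<open>eq2\<close>.\<close>
  have sign: "(-1 :: 'p padic) ^ M N = -1" for N using odd by (simp add: M_def)

  have "(c + 1) * T N - s * U N = (\<Sum>x<M N. (C (Suc x) + C x) * (-1) ^ x)" for N
    by (simp add: T_def U_def C_Suc sum_distrib_left sum_subtractf[symmetric] algebra_simps)
  hence eq1: "(c + 1) * T N - s * U N = 1 + C (M N)" for N
    by (simp only: alternating_sum_shift sign C0) simp
  have "(c + 1) * U N + s * T N = (\<Sum>x<M N. (S (Suc x) + S x) * (-1) ^ x)" for N
    by (simp add: T_def U_def S_Suc sum_distrib_left sum.distrib[symmetric] algebra_simps)
  hence eq2: "(c + 1) * U N + s * T N = S (M N)" for N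
    by (simp only: alternating_sum_shift sign C0) simp
  have "c ^ 2 + s ^ 2 = 1" unfolding c_def s_def by (rule padic_cos_sin_squared[OF odd a])
  hence det: "(c + 1) * (c + 1) + s * s = 2 * (c + 1)" by (simp add: algebra_simps power2_eq_square)
  have nz: "2 * (c + 1) \<noteq> 0"
    unfolding c_def mult_eq_0_iff using padic_cos_add_1_nonzero[OF odd a] by simp
  \<comment> \<open>Cramer's rule: \<open>c + 1\<close> times \<open>eq1\<close> plus
    \<open>s\<close> times \<open>eq2\<close> eliminates \<open>U\<close>; for \<open>U\<close>
    below, \<open>c + 1\<close> times \<open>eq2\<close> minus \<open>s\<close> times
    \<open>eq1\<close>.\<close>
  have "2 * (c + 1) * T N = (c + 1) * (1 + C (M N)) + s * S (M N)" for N
    unfolding eq1[symmetric] eq2[symmetric] det[symmetric] by (simp add: algebra_simps)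
  hence T: "T N = inverse (2 * (c + 1)) * ((c + 1) * (1 + C (M N)) + s * S (M N))" for N
    using nz by (metis left_inverse mult.assoc mult_1)
  have "2 * (c + 1) * U N = (c + 1) * S (M N) - s * (1 + C (M N))" for N
    unfolding eq1[symmetric] eq2[symmetric] det[symmetric] by (simp add: algebra_simps)
  hence U: "U N = inverse (2 * (c + 1)) * ((c + 1) * S (M N) - s * (1 + C (M N)))" for N
    using nz by (metis left_inverse mult.assoc mult_1)

  have q: "(\<lambda>N. (1 / real CARD('p)) ^ N) \<longlonglongrightarrow> 0"
    using CARD_gt_1[where 'p = 'p] by (intro LIMSEQ_realpow_zero) auto
  \<comment> \<open>The argument \<open>a * p ^ N\<close> tends to 0, which carries
    \<open>C (M N)\<close> to 1 and \<open>S (M N)\<close> to 0.\<close>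
  have "padic_norm (a * of_nat (M N)) \<le> (1 / real CARD('p)) ^ N" for N
    using a mult_right_mono[of "padic_norm a" 1 "(1 / real CARD('p)) ^ N"]
    by (simp add: M_def padic_norm_mult padic_norm_power padic_norm_of_nat_prime)
  hence "padic_norm (C (M N) - 1) \<le> (1 / real CARD('p)) ^ N"
    "padic_norm (S (M N) - 0) \<le> (1 / real CARD('p)) ^ N" for N
    using padic_norm_cos_diff_1[OF odd small, of "M N"] padic_norm_sin_le[OF odd small, of "M N"] order_trans
    by (fastforce simp: C_def S_def)+
  hence CM: "(\<lambda>N. C (M N)) \<longlonglongrightarrow> 1" and SM: "(\<lambda>N. S (M N)) \<longlonglongrightarrow> 0"
    by (auto intro!: tendsto_padic_sandwich[OF _ q] always_eventually)
  have "T \<longlonglongrightarrow> inverse (2 * (c + 1)) * ((c + 1) * (1 + 1) + s * 0)"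
    unfolding T by (intro tendsto_intros CM SM)
  moreover have "inverse (2 * (c + 1)) * ((c + 1) * (1 + 1) + s * 0) = 1"
    using nz by (simp add: field_simps)
  moreover have "U \<longlonglongrightarrow> inverse (2 * (c + 1)) * ((c + 1) * 0 - s * (1 + 1))"
    unfolding U by (intro tendsto_intros CM SM)
  moreover have "inverse (2 * (c + 1)) * ((c + 1) * 0 - s * (1 + 1)) = - (s / (c + 1))"
    using nz padic_cos_add_1_nonzero[OF odd a, folded c_def] by (simp add: field_simps)
  ultimately show "(\<lambda>N. \<Sum>x<CARD('p) ^ N. padic_cos (a * of_nat x) * (-1) ^ x) \<longlonglongrightarrow> 1"
    "(\<lambda>N. \<Sum>x<CARD('p) ^ N. padic_sin (a * of_nat x) * (-1) ^ x) \<longlonglongrightarrow>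
      - (padic_sin a / (padic_cos a + 1))"
    by (simp_all add: T_def U_def C_def S_def M_def c_def s_def)
qed

text \<open>Double-angle formulas at \<open>a / 2\<close>: the numerator is \<open>2 * s * c\<close>
  and the denominator \<open>2 * c * c\<close>.\<close>

lemma padic_tan_half: "padic_sin a / (padic_cos a + 1) = padic_tan (a / 2)"
proof -
  define c s where "c = padic_cos (a / 2)" and "s = padic_sin (a / 2)"
  have h: "padic_norm (a / 2) < 1" using a by (simp add: padic_norm_divide padic_norm_2[OF odd])
  have "padic_cos a = c * c - s * s" "padic_sin a = 2 * (s * c)"
    using padic_cos_add[OF odd h h] padic_sin_add[OF odd h h] by (simp_all add: c_def s_def)
  moreover have "c ^ 2 + s ^ 2 = 1" unfolding c_def s_def by (rule padic_cos_sin_squared[OF odd h])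
  hence "c * c - s * s + 1 = 2 * (c * c)" by (simp add: algebra_simps power2_eq_square flip: eq_diff_eq)
  moreover have "c \<noteq> 0" unfolding c_def by (rule padic_cos_nonzero[OF odd h])
  ultimately show ?thesis by (simp only: padic_tan_def flip: c_def s_def) simp
qed

end

text \<open>The two non-vanishing conjuncts ensure that the quotients are genuine and do not rest on
  the convention \<open>x / 0 = 0\<close>.\<close>

theorem proposition12:
  fixes a :: "'p::prime_card padic"
  assumes "odd CARD('p)"
    and "a \<in> padic_integers"
    and "\<forall>x\<in>padic_integers. a * x \<in> padic_trig_domain"
  shows "has_fermionic_integral (\<lambda>x. padic_cos (a * x)) 1 \<and>
    padic_cos a + 1 \<noteq> 0 \<and> padic_cos (a / 2) \<noteq> 0 \<and>
    has_fermionic_integral (\<lambda>x. padic_sin (a * x)) (- (padic_sin a / (padic_cos a + 1))) \<and>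
    - (padic_sin a / (padic_cos a + 1)) = - padic_tan (a / 2)"
proof -
  \<comment> \<open>The convergence hypothesis at \<open>x = 1\<close> concerns \<open>a\<close>
    itself and places it in the open unit disc.\<close>
  have "(1 :: 'p padic) \<in> padic_integers" by (simp add: padic_integers_def)
  hence "a \<in> padic_trig_domain" using assms(3) by fastforce
  hence a: "padic_norm a < 1" by (rule padic_trig_domain_norm_less_1)
  have h: "padic_norm (a / 2) < 1" using a by (simp add: padic_norm_divide padic_norm_2[OF assms(1)])
  note oa = assms(1) a
  show ?thesis
    unfolding has_fermionic_integral_def padic_tan_half[OF oa, symmetric]
    by (intro conjI refl strictly_differentiable_cos[OF oa] strictly_differentiable_sin[OF oa]
        fermionic_trig_limits[OF oa] padic_cos_add_1_nonzero[OF oa] padic_cos_nonzero[OF assms(1) h])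
qed

end
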